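(* Let $1\le n<\infty$. (a) Up to equivalence, the $\mathbb{Z}_3$-symmetric solutions for the cells of $\mathcal{D}^{(4n)\ast}$ are given by $W^+$ and $W^-$, where $$W^{\pm}_{i_l,j_l,k_{l+1}}=W^{\pm}_{i_l,j_{l+1},k_l}=W^{\pm}_{i_{l+1},j_l,k_l}=\frac{\sqrt{[2l][2l+2]}}{[2]\sqrt{[2l+1]}}\sqrt{[2l]\mp[1]},\quad l=1,\ldots,2n-2,$$ $$W^{\pm}_{i_l,j_{l+1},k_{l+1}}=W^{\pm}_{i_{l+1},j_l,k_{l+1}}=W^{\pm}_{i_{l+1},j_{l+1},k_l}=\frac{\sqrt{[2l][2l+2]}}{[2]\sqrt{[2l+1]}}\sqrt{[2l+2]\pm[1]},\quad l=1,\ldots,2n-2,$$ $$W^{\pm}_{i_l,j_l,k_l}=\begin{cases}(-1)^{l+1}\dfrac{\sqrt{[2l]}}{[2]\sqrt{[2l-1][2l+1]}}\sqrt{[2][2l]\pm[4l]}, & l=1,\ldots,n-1,\\[2mm](-1)^{n+1}\dfrac{[2n]}{\sqrt{[2][2n-1][2n+1]}}, & l=n,\\[2mm](-1)^{l+1}\dfrac{\sqrt{[2l]}}{[2]\sqrt{[2l-1][2l+1]}}\sqrt{[2][2l]\mp[8n-4l]}, & l=n+1,\ldots,2n-1.\end{cases}$$ (b) Up to equivalence, the $\mathbb{Z}_3$-symmetric solutions for the cells of $\mathcal{D}^{(4n+2)\ast}$ are given by $W^+$ and $W^-$, where $$W^{\pm}_{i_l,j_l,k_{l+1}}=W^{\pm}_{i_l,j_{l+1},k_l}=W^{\pm}_{i_{l+1},j_l,k_l}=\frac{\sqrt{[2l][2l+2]}}{[2]\sqrt{[2l+1]}}\sqrt{[2l]\mp[1]},\quad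 l=1,\ldots,2n-1,$$ $$W^{\pm}_{i_l,j_{l+1},k_{l+1}}=W^{\pm}_{i_{l+1},j_l,k_{l+1}}=W^{\pm}_{i_{l+1},j_{l+1},k_l}=\frac{\sqrt{[2l][2l+2]}}{[2]\sqrt{[2l+1]}}\sqrt{[2l+2]\pm[1]},\quad l=1,\ldots,2n-1,$$ $$W^{\pm}_{i_l,j_l,k_l}=\begin{cases}(-1)^{l+1}\dfrac{\sqrt{[2l]}}{[2]\sqrt{[2l-1][2l+1]}}\sqrt{[2][2l]\pm[4l]}, & l=1,\ldots,n,\\[2mm](-1)^{l+1}\dfrac{\sqrt{[2l]}}{[2]\sqrt{[2l-1][2l+1]}}\sqrt{[2][2l]\mp[8n+4-4l]}, & l=n+1,\ldots,2n.\end{cases}$$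
   Context: For the graph $\mathcal{D}^{(N)\ast}$ ($N=4n$ or $N=4n+2$) let $q=e^{\pi i/N}$ and $[m]=(q^m-q^{-m})/(q-q^{-1})$. For even $N$, the graph $\mathcal{D}^{(N)\ast}$ has vertices $i_l,j_l,k_l$, $l=1,\ldots,N/2-1$. For each pair $(l,m)$ with $1\le l,m\le N/2-1$ and $|l-m|\le 1$ there is exactly one edge $i_l\to j_m$, one edge $j_l\to k_m$ and one edge $k_l\to i_m$; there are no other edges. Its Perron-Frobenius eigenvector (eigenvalue $[3]$) is $\phi_{i_l}=\phi_{j_l}=\phi_{k_l}=[2l]/[2]$. $W_{a,b,c}$ denotes the value of $W$ on the triangle $a\to b\to c\to a$. A cell system $W$ on this graph is called a $\mathbb{Z}_3$-symmetric solution if $|W_{i_p,j_q,k_r}|=|W_{i_q,j_r,k_p}|=|W_{i_r,j_p,k_q}|$ for all triangles. Cell systems: let $\mathcal{G}$ be a directed graph (loops and multiple edges allowed), with source and range maps $s,r$, Perron-Frobenius eigenvalue $[3]$ and positive Perron-Frobenius eigenvector $(\phi_i)$. A triangle $\triangle_{ijk}^{(\alpha\beta\gamma)}$ is a closed path $i\xrightarrow{\alpha}j\xrightarrow{\beta}k\xrightarrow{\gamma}i$, considered up to cyclic rotation. A cell system $W$ assigns to each triangle a complex number $W(\triangle_{ijk}^{(\alpha\beta\gamma)})$ such that: (I) for all edges $\alpha,\alpha'$ from $i$ to $j$, $\sum_{k,\beta,\gamma}W(\triangle_{ijk}^{(\alpha\beta\gamma)})\overline{W(\triangle_{ijk}^{(\alpha'\beta\gamma)})}=\delta_{\alpha,\alpha'}[2]\phi_i\phi_j$,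 the sum being over vertices $k$ and edges $\beta:j\to k$, $\gamma:k\to i$; (II) for all edges $\alpha_1,\dots,\alpha_4$ with $s(\alpha_1)=s(\alpha_4)=i_1$, $r(\alpha_1)=r(\alpha_2)=i_2$, $s(\alpha_2)=s(\alpha_3)=i_3$, $r(\alpha_3)=r(\alpha_4)=i_4$ (here $i_1,\dots,i_4$ are arbitrary vertices of $\mathcal{G}$), $$\sum\phi_k^{-1}W(\triangle_{i_1i_2k}^{(\alpha_1\beta_1\beta_2)})\overline{W(\triangle_{i_3i_2k}^{(\alpha_2\beta_1\beta_3)})}W(\triangle_{i_3i_4k}^{(\alpha_3\beta_4\beta_3)})\overline{W(\triangle_{i_1i_4k}^{(\alpha_4\beta_4\beta_2)})}=\delta_{\alpha_1,\alpha_4}\delta_{\alpha_2,\alpha_3}\phi_{i_1}\phi_{i_2}\phi_{i_3}+\delta_{\alpha_1,\alpha_2}\delta_{\alpha_3,\alpha_4}\phi_{i_1}\phi_{i_2}\phi_{i_4},$$ the sum being over vertices $k$ and edges $\beta_1:i_2\to k$, $\beta_2:k\to i_1$, $\beta_3:k\to i_3$, $\beta_4:i_4\to k$. Two cell systems $W_1,W_2$ on $\mathcal{G}$ are equivalent if for each pair of adjacent vertices $i,j$ there is a unitary matrix $(u(\sigma,\sigma'))$ indexed by the edges from $i$ to $j$ such that for every triangle $W_1(\triangle_{ijk}^{(\sigma\rho\gamma)})=\sum_{\sigma',\rho',\gamma'}u(\sigma,\sigma')u(\rho,\rho')u(\gamma,\gamma')W_2(\triangle_{ijk}^{(\sigma'\rho'\gamma')})$,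 summing over edges $\sigma':i\to j$, $\rho':j\to k$, $\gamma':k\to i$. *)

theory Defs
  imports "HOL-Analysis.Analysis" "Graph_Theory.Digraph"
begin

section \<open>Quantum integers\<close>

definition qroot :: "nat \<Rightarrow> complex" where
  "qroot N = exp (of_real pi * \<i> / of_nat N)"

text \<open>The quotient is a real number (lemma \<open>of_real_qint\<close>), so taking the real part only
  changes the type; it is needed because square roots of quantum integers occur below.\<close>

definition qint :: "nat \<Rightarrow> nat \<Rightarrow> real" where
  "qint N m = Re ((qroot N ^ m - inverse (qroot N) ^ m) / (qroot N - inverse (qroot N)))"

lemma qint_complex:
  "(qroot N ^ m - inverse (qroot N) ^ m) / (qroot N - inverse (qroot N))
     = of_real (sin (real m * (pi / real N)) / sin (pi / real N))"
proof -
  define t where "t = pi / real N"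
  have q: "qroot N = cis t"
    by (simp add: qroot_def t_def cis_conv_exp mult.commute)
  have i: "inverse (qroot N) = cis (- t)"
    by (simp add: q)
  have d: "cis a - cis (- a) = 2 * \<i> * of_real (sin a)" for a
    by (simp add: complex_eq_iff)
  have "(qroot N ^ m - inverse (qroot N) ^ m) / (qroot N - inverse (qroot N))
     = (cis (real m * t) - cis (- (real m * t))) / (cis t - cis (- t))"
    unfolding i unfolding q by (simp only: Complex.DeMoivre mult_minus_right)
  then show ?thesis
    unfolding d by (simp add: t_def)
qed

lemma qint_sin: "qint N m = sin (real m * (pi / real N)) / sin (pi / real N)"
  unfolding qint_def qint_complex by (rule Re_complex_of_real)

lemma of_real_qint:
  "of_real (qint N m) = (qroot N ^ m - inverse (qroot N) ^ m) / (qroot N - inverse (qroot N))"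
  by (simp only: qint_complex qint_sin)

section \<open>Cell systems on a directed graph\<close>

definition arcs_from_to :: "('v, 'e) pre_digraph \<Rightarrow> 'v \<Rightarrow> 'v \<Rightarrow> 'e set" where
  "arcs_from_to G i j = {e \<in> arcs G. tail G e = i \<and> head G e = j}"

definition perron_frobenius :: "('v, 'e) pre_digraph \<Rightarrow> real \<Rightarrow> ('v \<Rightarrow> real) \<Rightarrow> bool" where
  "perron_frobenius G c \<phi> \<longleftrightarrow>
     (\<forall>v\<in>verts G. \<phi> v > 0 \<and> (\<Sum>e\<in>out_arcs G v. \<phi> (head G e)) = c * \<phi> v)"

text \<open>\<open>W \<alpha> \<beta> \<gamma>\<close> is the value of \<open>W\<close> on the triangle formed by the consecutive edges
  \<open>\<alpha>\<close>, \<open>\<beta>\<close>, \<open>\<gamma>\<close>; the values on other triples of edges are irrelevant. Triangles are taken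
  up to cyclic rotation, whence the first condition.\<close>

type_synonym 'e cells = "'e \<Rightarrow> 'e \<Rightarrow> 'e \<Rightarrow> complex"

definition rotation_invariant :: "('v, 'e) pre_digraph \<Rightarrow> 'e cells \<Rightarrow> bool" where
  "rotation_invariant G W \<longleftrightarrow>
     (\<forall>i\<in>verts G. \<forall>j\<in>verts G. \<forall>k\<in>verts G.
        \<forall>\<alpha>\<in>arcs_from_to G i j. \<forall>\<beta>\<in>arcs_from_to G j k. \<forall>\<gamma>\<in>arcs_from_to G k i.
          W \<alpha> \<beta> \<gamma> = W \<beta> \<gamma> \<alpha>)"

definition type_I :: "nat \<Rightarrow> ('v, 'e) pre_digraph \<Rightarrow> ('v \<Rightarrow> real) \<Rightarrow> 'e cells \<Rightarrow> bool" where
  "type_I N G \<phi> W \<longleftrightarrow>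
     (\<forall>i\<in>verts G. \<forall>j\<in>verts G. \<forall>\<alpha>\<in>arcs_from_to G i j. \<forall>\<alpha>'\<in>arcs_from_to G i j.
        (\<Sum>k\<in>verts G. \<Sum>\<beta>\<in>arcs_from_to G j k. \<Sum>\<gamma>\<in>arcs_from_to G k i.
           W \<alpha> \<beta> \<gamma> * cnj (W \<alpha>' \<beta> \<gamma>))
        = of_bool (\<alpha> = \<alpha>') * of_real (qint N 2 * \<phi> i * \<phi> j))"

definition type_II :: "('v, 'e) pre_digraph \<Rightarrow> ('v \<Rightarrow> real) \<Rightarrow> 'e cells \<Rightarrow> bool" where
  "type_II G \<phi> W \<longleftrightarrow>
     (\<forall>i1\<in>verts G. \<forall>i2\<in>verts G. \<forall>i3\<in>verts G. \<forall>i4\<in>verts G.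
      \<forall>\<alpha>1\<in>arcs_from_to G i1 i2. \<forall>\<alpha>2\<in>arcs_from_to G i3 i2.
      \<forall>\<alpha>3\<in>arcs_from_to G i3 i4. \<forall>\<alpha>4\<in>arcs_from_to G i1 i4.
        (\<Sum>k\<in>verts G.
           \<Sum>\<beta>1\<in>arcs_from_to G i2 k. \<Sum>\<beta>2\<in>arcs_from_to G k i1.
           \<Sum>\<beta>3\<in>arcs_from_to G k i3. \<Sum>\<beta>4\<in>arcs_from_to G i4 k.
             of_real (inverse (\<phi> k)) * W \<alpha>1 \<beta>1 \<beta>2 * cnj (W \<alpha>2 \<beta>1 \<beta>3)
               * W \<alpha>3 \<beta>4 \<beta>3 * cnj (W \<alpha>4 \<beta>4 \<beta>2))
        = of_bool (\<alpha>1 = \<alpha>4) * of_bool (\<alpha>2 = \<alpha>3) * of_real (\<phi> i1 * \<phi> i2 * \<phi> i3)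
          + of_bool (\<alpha>1 = \<alpha>2) * of_bool (\<alpha>3 = \<alpha>4) * of_real (\<phi> i1 * \<phi> i2 * \<phi> i4))"

definition cell_system :: "nat \<Rightarrow> ('v, 'e) pre_digraph \<Rightarrow> ('v \<Rightarrow> real) \<Rightarrow> 'e cells \<Rightarrow> bool" where
  "cell_system N G \<phi> W \<longleftrightarrow> rotation_invariant G W \<and> type_I N G \<phi> W \<and> type_II G \<phi> W"

definition unitary_matrix_on :: "'e set \<Rightarrow> ('e \<Rightarrow> 'e \<Rightarrow> complex) \<Rightarrow> bool" where
  "unitary_matrix_on E u \<longleftrightarrow>
     (\<forall>x\<in>E. \<forall>y\<in>E. (\<Sum>z\<in>E. u x z * cnj (u y z)) = of_bool (x = y)
                 \<and> (\<Sum>z\<in>E. cnj (u z x) * u z y) = of_bool (x = y))"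

text \<open>One function \<open>u\<close> on pairs of edges encodes the whole family of unitary matrices: only its
  restrictions to the sets of edges from \<open>i\<close> to \<open>j\<close> matter, and these sets are disjoint.\<close>

definition cell_equivalent :: "('v, 'e) pre_digraph \<Rightarrow> 'e cells \<Rightarrow> 'e cells \<Rightarrow> bool" where
  "cell_equivalent G W1 W2 \<longleftrightarrow>
     (\<exists>u. (\<forall>i\<in>verts G. \<forall>j\<in>verts G. unitary_matrix_on (arcs_from_to G i j) u) \<and>
        (\<forall>i\<in>verts G. \<forall>j\<in>verts G. \<forall>k\<in>verts G.
           \<forall>\<sigma>\<in>arcs_from_to G i j. \<forall>\<rho>\<in>arcs_from_to G j k. \<forall>\<gamma>\<in>arcs_from_to G k i.
             W1 \<sigma> \<rho> \<gamma> =
               (\<Sum>\<sigma>'\<in>arcs_from_to G i j. \<Sum>\<rho>'\<in>arcs_from_to G j k. \<Sum>\<gamma>'\<in>arcs_from_to G k i.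
                  u \<sigma> \<sigma>' * u \<rho> \<rho>' * u \<gamma> \<gamma>' * W2 \<sigma>' \<rho>' \<gamma>')))"

section \<open>The graph \<open>\<D>\<^bsup>(N)*\<^esup>\<close> for even \<open>N\<close>\<close>

datatype vertex = vi nat | vj nat | vk nat

definition Dstar :: "nat \<Rightarrow> (vertex, vertex \<times> vertex) pre_digraph" where
  "Dstar N = (let L = {1..<N div 2} in
     \<lparr> verts = vi ` L \<union> vj ` L \<union> vk ` L,
       arcs = (\<Union>l\<in>L. \<Union>m\<in>{m \<in> L. \<bar>int l - int m\<bar> \<le> 1}.
                 {(vi l, vj m), (vj l, vk m), (vk l, vi m)}),
       tail = fst, head = snd \<rparr>)"

fun level :: "vertex \<Rightarrow> nat" where
  "level (vi l) = l" | "level (vj l) = l" | "level (vk l) = l"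

definition Dstar_phi :: "nat \<Rightarrow> vertex \<Rightarrow> real" where
  "Dstar_phi N v = qint N (2 * level v) / qint N 2"

lemma Dstar_simps:
  "verts (Dstar N) = vi ` {1..<N div 2} \<union> vj ` {1..<N div 2} \<union> vk ` {1..<N div 2}"
  "tail (Dstar N) = fst" "head (Dstar N) = snd"
  by (simp_all add: Dstar_def Let_def)

lemma Dstar_out_arcs:
  assumes "l \<in> {1..<N div 2}"
  defines "M \<equiv> {m \<in> {1..<N div 2}. \<bar>int l - int m\<bar> \<le> 1}"
  shows "out_arcs (Dstar N) (vi l) = (\<lambda>m. (vi l, vj m)) ` M"
    and "out_arcs (Dstar N) (vj l) = (\<lambda>m. (vj l, vk m)) ` M"
    and "out_arcs (Dstar N) (vk l) = (\<lambda>m. (vk l, vi m)) ` M"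
  using assms by (auto simp: out_arcs_def Dstar_def Let_def)

lemma qint_3: "qint N 3 * qint N (2 * l) = qint N (2 * l) + qint N (2 * l - 2) + qint N (2 * l + 2)"
  if "l \<ge> 1" "N \<ge> 2"
proof -
  define t where "t = pi / real N"
  have "0 < t" "t < pi" using that by (auto simp: t_def field_simps)
  then have s: "sin t \<noteq> 0" using sin_gt_zero by force
  have three: "sin (3 * t) = sin t * (1 + 2 * cos (2 * t))"
  proof -
    have "sin (3 * t) = sin (2 * t + t)" by simp
    also have "\<dots> = sin t * (1 + 2 * cos (2 * t))"
      unfolding sin_add sin_double cos_double using sin_cos_squared_add[of t] by algebra
    finally show ?thesis .
  qed
  have m: "real (2 * l - 2) = 2 * real l - 2" using that by linarith
  have pm: "sin (real (2 * l - 2) * t) + sin (real (2 * l + 2) * t)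
      = 2 * sin (real (2 * l) * t) * cos (2 * t)"
    unfolding m by (simp add: left_diff_distrib distrib_right sin_diff sin_add)
  have "sin (real 3 * t) * sin (real (2 * l) * t)
      = sin t * (sin (real (2 * l) * t) + sin (real (2 * l - 2) * t) + sin (real (2 * l + 2) * t))"
    using three pm by (simp add: algebra_simps)
  then show ?thesis
    unfolding qint_sin t_def[symmetric] using s by (simp add: field_simps)
qed

lemma perron_frobenius_Dstar:
  assumes "even N" "N \<ge> 4"
  shows "perron_frobenius (Dstar N) (qint N 3) (Dstar_phi N)"
proof -
  have pos: "qint N m > 0" if "0 < m" "m < N" for m
    unfolding qint_sin using that assms
    by (intro divide_pos_pos sin_gt_zero) (auto simp: field_simps)
  have zero: "qint N 0 = 0" "qint N N = 0"
    using assms by (auto simp: qint_sin)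
  have two: "qint N 2 > 0" using pos assms by simp
  have eig: "(\<Sum>m\<in>{m \<in> {1..<N div 2}. \<bar>int l - int m\<bar> \<le> 1}. qint N (2 * m) / qint N 2)
      = qint N 3 * (qint N (2 * l) / qint N 2)" if l: "l \<in> {1..<N div 2}" for l
  proof -
    have "(\<Sum>m\<in>{m \<in> {1..<N div 2}. \<bar>int l - int m\<bar> \<le> 1}. qint N (2 * m))
        = (\<Sum>m\<in>{l - 1, l, l + 1}. qint N (2 * m))"
    proof (rule sum.mono_neutral_left)
      show "\<forall>m\<in>{l - 1, l, l + 1} - {m \<in> {1..<N div 2}. \<bar>int l - int m\<bar> \<le> 1}. qint N (2 * m) = 0"
      proof
        fix m assume "m \<in> {l - 1, l, l + 1} - {m \<in> {1..<N div 2}. \<bar>int l - int m\<bar> \<le> 1}"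
        then have "m = 0 \<or> 2 * m = N" using l assms by auto
        then show "qint N (2 * m) = 0" using zero by auto
      qed
    qed auto
    also have "\<dots> = qint N (2 * (l - 1)) + qint N (2 * l) + qint N (2 * (l + 1))"
    proof -
      have "l - 1 \<noteq> l" "l - 1 \<noteq> l + 1" using l by auto
      then show ?thesis by simp
    qed
    also have "\<dots> = qint N 3 * qint N (2 * l)"
      using l assms by (subst qint_3) (auto simp: diff_mult_distrib2)
    finally show ?thesis by (simp add: sum_divide_distrib[symmetric])
  qed
  show ?thesis
    unfolding perron_frobenius_def
  proof
    fix v assume "v \<in> verts (Dstar N)"
    then obtain l where l: "l \<in> {1..<N div 2}" and v: "v = vi l \<or> v = vj l \<or> v = vk l"
      by (auto simp: Dstar_simps)
    have "Dstar_phi N v > 0"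
      using l v pos[of "2 * l"] two by (auto simp: Dstar_phi_def)
    moreover have "(\<Sum>e\<in>out_arcs (Dstar N) v. Dstar_phi N (head (Dstar N) e)) = qint N 3 * Dstar_phi N v"
      using v Dstar_out_arcs[OF l] eig[OF l]
      by (auto simp: sum.reindex inj_on_def Dstar_simps Dstar_phi_def)
    ultimately show "Dstar_phi N v > 0 \<and>
        (\<Sum>e\<in>out_arcs (Dstar N) v. Dstar_phi N (head (Dstar N) e)) = qint N 3 * Dstar_phi N v" ..
  qed
qed

text \<open>\<open>cell_at W a b c\<close> is $W_{a,b,c}$. As there are no multiple edges, a triangle is determined
  by its vertices.\<close>

definition cell_at :: "(vertex \<times> vertex) cells \<Rightarrow> vertex \<Rightarrow> vertex \<Rightarrow> vertex \<Rightarrow> complex" where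
  "cell_at W a b c = W (a, b) (b, c) (c, a)"

definition Z3_symmetric_solution :: "nat \<Rightarrow> (vertex \<times> vertex) cells \<Rightarrow> bool" where
  "Z3_symmetric_solution N W \<longleftrightarrow>
     cell_system N (Dstar N) (Dstar_phi N) W \<and>
     (\<forall>p q r. (vi p, vj q) \<in> arcs (Dstar N) \<and> (vj q, vk r) \<in> arcs (Dstar N)
                \<and> (vk r, vi p) \<in> arcs (Dstar N) \<longrightarrow>
        cmod (cell_at W (vi p) (vj q) (vk r)) = cmod (cell_at W (vi q) (vj r) (vk p)) \<and>
        cmod (cell_at W (vi q) (vj r) (vk p)) = cmod (cell_at W (vi r) (vj p) (vk q)))"

section \<open>The solutions \<open>W\<^sup>+\<close> and \<open>W\<^sup>-\<close>\<close>

text \<open>The parameter \<open>s\<close> is the sign: \<open>s = 1\<close> for \<open>W\<^sup>+\<close> and \<open>s = -1\<close> for \<open>W\<^sup>-\<close>.\<close>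

definition val_one_up :: "nat \<Rightarrow> real \<Rightarrow> nat \<Rightarrow> real" where
  "val_one_up N s l =
     sqrt (qint N (2 * l) * qint N (2 * l + 2)) / (qint N 2 * sqrt (qint N (2 * l + 1)))
       * sqrt (qint N (2 * l) - s * qint N 1)"

definition val_two_up :: "nat \<Rightarrow> real \<Rightarrow> nat \<Rightarrow> real" where
  "val_two_up N s l =
     sqrt (qint N (2 * l) * qint N (2 * l + 2)) / (qint N 2 * sqrt (qint N (2 * l + 1)))
       * sqrt (qint N (2 * l + 2) + s * qint N 1)"

definition val_diag_4n :: "nat \<Rightarrow> real \<Rightarrow> nat \<Rightarrow> real" where
  "val_diag_4n n s l = (let N = 4 * n in
     if l < n then
       (-1) ^ (l + 1) * (sqrt (qint N (2 * l)) / (qint N 2 * sqrt (qint N (2 * l - 1) * qint N (2 * l + 1))))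
         * sqrt (qint N 2 * qint N (2 * l) + s * qint N (4 * l))
     else if l = n then
       (-1) ^ (n + 1) * (qint N (2 * n) / sqrt (qint N 2 * qint N (2 * n - 1) * qint N (2 * n + 1)))
     else
       (-1) ^ (l + 1) * (sqrt (qint N (2 * l)) / (qint N 2 * sqrt (qint N (2 * l - 1) * qint N (2 * l + 1))))
         * sqrt (qint N 2 * qint N (2 * l) - s * qint N (8 * n - 4 * l)))"

definition val_diag_4n2 :: "nat \<Rightarrow> real \<Rightarrow> nat \<Rightarrow> real" where
  "val_diag_4n2 n s l = (let N = 4 * n + 2 in
     if l \<le> n then
       (-1) ^ (l + 1) * (sqrt (qint N (2 * l)) / (qint N 2 * sqrt (qint N (2 * l - 1) * qint N (2 * l + 1))))
         * sqrt (qint N 2 * qint N (2 * l) + s * qint N (4 * l))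
     else
       (-1) ^ (l + 1) * (sqrt (qint N (2 * l)) / (qint N 2 * sqrt (qint N (2 * l - 1) * qint N (2 * l + 1))))
         * sqrt (qint N 2 * qint N (2 * l) - s * qint N (8 * n + 4 - 4 * l)))"

text \<open>The value on the triangle $i_p \to j_q \to k_r \to i_p$, given the diagonal values \<open>d\<close>.
  On a triangle two levels differ by at most one, so the last branch is never reached.\<close>

definition val_ijk :: "nat \<Rightarrow> real \<Rightarrow> (nat \<Rightarrow> real) \<Rightarrow> nat \<Rightarrow> nat \<Rightarrow> nat \<Rightarrow> real" where
  "val_ijk N s d p q r = (let l = min p (min q r) in
     if (p, q, r) = (l, l, l) then d l
     else if (p, q, r) \<in> {(l, l, l + 1), (l, l + 1, l), (l + 1, l, l)} then val_one_up N s l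
     else if (p, q, r) \<in> {(l, l + 1, l + 1), (l + 1, l, l + 1), (l + 1, l + 1, l)} then val_two_up N s l
     else 0)"

fun rotated :: "(nat \<Rightarrow> nat \<Rightarrow> nat \<Rightarrow> real) \<Rightarrow> vertex \<Rightarrow> vertex \<Rightarrow> vertex \<Rightarrow> real" where
  "rotated f (vi p) (vj q) (vk r) = f p q r"
| "rotated f (vj q) (vk r) (vi p) = f p q r"
| "rotated f (vk r) (vi p) (vj q) = f p q r"
| "rotated f _ _ _ = 0"

definition W_4n :: "nat \<Rightarrow> real \<Rightarrow> (vertex \<times> vertex) cells" where
  "W_4n n s \<alpha> \<beta> \<gamma> =
     of_real (rotated (val_ijk (4 * n) s (val_diag_4n n s)) (fst \<alpha>) (fst \<beta>) (fst \<gamma>))"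

definition W_4n2 :: "nat \<Rightarrow> real \<Rightarrow> (vertex \<times> vertex) cells" where
  "W_4n2 n s \<alpha> \<beta> \<gamma> =
     of_real (rotated (val_ijk (4 * n + 2) s (val_diag_4n2 n s)) (fst \<alpha>) (fst \<beta>) (fst \<gamma>))"

lemma W_4n_values:
  "cell_at (W_4n n s) (vi l) (vj l) (vk (l + 1)) = of_real (val_one_up (4 * n) s l)"
  "cell_at (W_4n n s) (vi l) (vj (l + 1)) (vk l) = of_real (val_one_up (4 * n) s l)"
  "cell_at (W_4n n s) (vi (l + 1)) (vj l) (vk l) = of_real (val_one_up (4 * n) s l)"
  "cell_at (W_4n n s) (vi l) (vj (l + 1)) (vk (l + 1)) = of_real (val_two_up (4 * n) s l)"
  "cell_at (W_4n n s) (vi (l + 1)) (vj l) (vk (l + 1)) = of_real (val_two_up (4 * n) s l)"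
  "cell_at (W_4n n s) (vi (l + 1)) (vj (l + 1)) (vk l) = of_real (val_two_up (4 * n) s l)"
  "cell_at (W_4n n s) (vi l) (vj l) (vk l) = of_real (val_diag_4n n s l)"
  by (simp_all add: cell_at_def W_4n_def val_ijk_def Let_def)

lemma W_4n2_values:
  "cell_at (W_4n2 n s) (vi l) (vj l) (vk (l + 1)) = of_real (val_one_up (4 * n + 2) s l)"
  "cell_at (W_4n2 n s) (vi l) (vj (l + 1)) (vk l) = of_real (val_one_up (4 * n + 2) s l)"
  "cell_at (W_4n2 n s) (vi (l + 1)) (vj l) (vk l) = of_real (val_one_up (4 * n + 2) s l)"
  "cell_at (W_4n2 n s) (vi l) (vj (l + 1)) (vk (l + 1)) = of_real (val_two_up (4 * n + 2) s l)"
  "cell_at (W_4n2 n s) (vi (l + 1)) (vj l) (vk (l + 1)) = of_real (val_two_up (4 * n + 2) s l)"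
  "cell_at (W_4n2 n s) (vi (l + 1)) (vj (l + 1)) (vk l) = of_real (val_two_up (4 * n + 2) s l)"
  "cell_at (W_4n2 n s) (vi l) (vj l) (vk l) = of_real (val_diag_4n2 n s l)"
  by (simp_all add: cell_at_def W_4n2_def val_ijk_def Let_def)

end

theory Submission
  imports Defs
begin

text \<open>
  On \<open>\<D>\<^bsup>(N)*\<^esup>\<close> there are no multiple edges, so a cell system is a function of three levels
  \<open>p, q, r\<close> that are pairwise at distance at most one, and the equations of type I and II become
  equations between its values. Under $\mathbb{Z}_3$-symmetry the moduli are given by three
  sequences: $a_l$, $b_l$, $c_l$ are the squared moduli on the triangles whose levels are
  $(l,l,l)$, $(l,l,l+1)$ and $(l,l+1,l+1)$, up to rotation. With \<open>\<phi>\<^sub>l = [2l]/[2]\<close>, the equations contain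
  \<^item> $b_l + c_l = [2]\phi_l\phi_{l+1}$ and $c_{l-1} + a_l + b_l = [2]\phi_l^2$ (type I),
  \<^item> $c_l b_{l+1} = \phi_l\phi_{l+1}^2\phi_{l+2}$ (type II on the square with levels $l, l+1, l+2, l+1$),
  \<^item> $b_1^2/\phi_1 + c_1^2/\phi_2 = \phi_1\phi_2(\phi_1+\phi_2)$ (type II on a degenerate square).

  The last equation together with $b_1 + c_1 = [2]\phi_1\phi_2$ is a quadratic equation for $b_1$,
  and the first three then determine everything else from $b_1$ (\<open>moduli_determined\<close>). The two roots
  are the values of \<open>W\<^sup>+\<close> and \<open>W\<^sup>-\<close>, so any solution has the moduli of one of them
  (\<open>start_determined\<close>).

  The phases are constrained only on squares with two distinct levels on both sides. There the type II
  equation has two terms that cancel; comparing with the same equation for \<open>W\<^sup>\<plusminus>\<close>, the alternating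
  product of the relative phases over the eight vertices of the cube $\{l,l+1\}^3$ is 1. This is exactly the
  condition under which the relative phase is a product of phases attached to edges, and consecutive
  cubes share only one vertex, so that the choices for them are compatible (\<open>gauge\<close>).

  That \<open>W\<^sup>\<plusminus>\<close> are solutions is a computation with quantum integers. It is short in terms of
  $\rho_l = ([2l]\mp 1)/[2l+1] = [2l-1]/([2l]\pm 1)$: then
  $b_l = \phi_l\phi_{l+1}\rho_l$, $c_{l-1} = \phi_{l-1}\phi_l\rho_l^{-1}$ and
  $a_l = \pm [2l](\rho_l^{-1}-\rho_l)/[2]^2$.
  Both families of diagonal values in the theorem, for $N = 4n$ and $N = 4n+2$, come from one
  formula (\<open>diag_cell\<close>), because $[2N-m] = -[m]$.
\<close>

section \<open>Cell equations in terms of levels\<close>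

definition near :: "nat \<Rightarrow> nat \<Rightarrow> bool" where
  "near l m \<longleftrightarrow> \<bar>int l - int m\<bar> \<le> 1"

definition levels :: "nat \<Rightarrow> nat set" where
  "levels N = {1..<N div 2}"

text \<open>For an edge from level \<open>p\<close> to level \<open>q\<close>, these are the levels of the third vertices of the triangles through it.\<close>

definition apexes :: "nat \<Rightarrow> nat \<Rightarrow> nat \<Rightarrow> nat set" where
  "apexes N p q = {r \<in> levels N. near q r \<and> near r p}"

abbreviation level_phi :: "nat \<Rightarrow> nat \<Rightarrow> real" where
  "level_phi N l \<equiv> qint N (2 * l) / qint N 2"

text \<open>A function of levels \<open>f p q r\<close> stands for the cells on the triangles $i_p \to j_q \to k_r$, or with the
  types \<open>i, j, k\<close> cyclically permuted. As there is at most one edge between two vertices, the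
  equations for two distinct parallel edges are void.\<close>

definition level_I :: "nat \<Rightarrow> (nat \<Rightarrow> nat \<Rightarrow> nat \<Rightarrow> complex) \<Rightarrow> bool" where
  "level_I N f \<longleftrightarrow> (\<forall>p\<in>levels N. \<forall>q\<in>levels N. near p q \<longrightarrow>
     (\<Sum>r\<in>apexes N p q. (cmod (f p q r))\<^sup>2) = qint N 2 * level_phi N p * level_phi N q)"

definition level_II :: "nat \<Rightarrow> (nat \<Rightarrow> nat \<Rightarrow> nat \<Rightarrow> complex) \<Rightarrow> bool" where
  "level_II N f \<longleftrightarrow> (\<forall>p\<in>levels N. \<forall>q\<in>levels N. \<forall>p'\<in>levels N. \<forall>q'\<in>levels N.
     near p q \<and> near p' q \<and> near p' q' \<and> near p q' \<longrightarrow>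
     (\<Sum>r\<in>apexes N p q \<inter> apexes N p' q'. of_real (inverse (level_phi N r))
        * f p q r * cnj (f p' q r) * f p' q' r * cnj (f p q' r))
     = of_bool (q = q') * of_real (level_phi N p * level_phi N q * level_phi N p')
       + of_bool (p = p') * of_real (level_phi N p * level_phi N q * level_phi N q'))"

text \<open>Edges run from \<open>i\<close> to \<open>j\<close> to \<open>k\<close> to \<open>i\<close>. Treating the three types as a variable triple
  reduces every statement about the graph to one case.\<close>

definition cyclic_types :: "(nat \<Rightarrow> vertex) \<Rightarrow> (nat \<Rightarrow> vertex) \<Rightarrow> (nat \<Rightarrow> vertex) \<Rightarrow> bool" where
  "cyclic_types A B C \<longleftrightarrow> (A, B, C) \<in> {(vi, vj, vk), (vj, vk, vi), (vk, vi, vj)}"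

lemma level_in_levels: "v \<in> verts (Dstar N) \<Longrightarrow> level v \<in> levels N"
  by (auto simp: Dstar_simps levels_def)

lemma arcs_from_to_Dstar:
  "arcs_from_to (Dstar N) v w =
     (if v \<in> verts (Dstar N) \<and> w \<in> verts (Dstar N) \<and> near (level v) (level w)
         \<and> (\<exists>A B C l m. cyclic_types A B C \<and> v = A l \<and> w = B m)
      then {(v, w)} else {})"
  by (cases v; cases w)
    (auto simp: arcs_from_to_def Dstar_def Let_def near_def cyclic_types_def)

lemma arcs_from_to_types:
  assumes "cyclic_types A B C"
  shows "arcs_from_to (Dstar N) (A l) (B m) =
    (if l \<in> levels N \<and> m \<in> levels N \<and> near l m then {(A l, B m)} else {})"
    and "arcs_from_to (Dstar N) (B l) (C m) =
    (if l \<in> levels N \<and> m \<in> levels N \<and> near l m then {(B l, C m)} else {})"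
    and "arcs_from_to (Dstar N) (C l) (A m) =
    (if l \<in> levels N \<and> m \<in> levels N \<and> near l m then {(C l, A m)} else {})"
    and "arcs_from_to (Dstar N) (B l) (A m) = {}"
    and "arcs_from_to (Dstar N) (B l) (B m) = {}"
  using assms
  by (auto simp: arcs_from_to_def Dstar_def Let_def near_def cyclic_types_def levels_def)

lemma level_types:
  assumes "cyclic_types A B C" shows "Dstar_phi N (A l) = level_phi N l"
    "Dstar_phi N (B l) = level_phi N l" "Dstar_phi N (C l) = level_phi N l"
  using assms by (auto simp: cyclic_types_def Dstar_phi_def)

lemma of_bool_idem: "of_bool P * of_bool P = (of_bool P :: 'a::semiring_1)"
  by simp

lemma verts_types:
  assumes "cyclic_types A B C"
  shows "verts (Dstar N) = A ` levels N \<union> B ` levels N \<union> C ` levels N"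
    "inj A" "inj B" "inj C" "A ` levels N \<inter> B ` levels N = {}"
    "(A ` levels N \<union> B ` levels N) \<inter> C ` levels N = {}"
    "A l = A m \<longleftrightarrow> l = m" "B l = B m \<longleftrightarrow> l = m"
  using assms by (auto simp: cyclic_types_def Dstar_simps levels_def inj_on_def)

lemma finite_levels [simp]: "finite (levels N)"
  by (simp add: levels_def)

lemma finite_apexes [simp]: "finite (apexes N p q)"
  by (simp add: apexes_def)

text \<open>In the sums of the cell equations the free vertex has the third type: summands at vertices of the
  other two types are sums over empty sets of arcs.\<close>

lemma sum_verts_third_type:
  fixes h :: "vertex \<Rightarrow> 'a::comm_monoid_add"
  assumes t: "cyclic_types A B C"
    and zero: "\<And>l. h (A l) = 0" "\<And>l. h (B l) = 0"
  shows "(\<Sum>v\<in>verts (Dstar N). h v) = (\<Sum>r\<in>levels N. h (C r))"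
proof -
  note v = verts_types[OF t]
  have i: "inj_on A X" "inj_on B X" "inj_on C X" for X
    using v(2-4) by (auto intro: inj_on_subset)
  show ?thesis
    unfolding v(1) by (simp add: sum.union_disjoint v(5,6) sum.reindex i zero)
qed

lemma sum_arcs_I:
  fixes F :: "vertex \<times> vertex \<Rightarrow> vertex \<times> vertex \<Rightarrow> 'a::comm_monoid_add"
  assumes t: "cyclic_types A B C" and "p \<in> levels N" "q \<in> levels N"
  shows "(\<Sum>k\<in>verts (Dstar N). \<Sum>\<beta>\<in>arcs_from_to (Dstar N) (B q) k.
           \<Sum>\<gamma>\<in>arcs_from_to (Dstar N) k (A p). F \<beta> \<gamma>)
       = (\<Sum>r\<in>apexes N p q. F (B q, C r) (C r, A p))"
proof (subst sum_verts_third_type[OF t])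
  show "(\<Sum>r\<in>levels N. \<Sum>\<beta>\<in>arcs_from_to (Dstar N) (B q) (C r).
           \<Sum>\<gamma>\<in>arcs_from_to (Dstar N) (C r) (A p). F \<beta> \<gamma>)
       = (\<Sum>r\<in>apexes N p q. F (B q, C r) (C r, A p))"
    unfolding apexes_def
    by (subst sum.inter_filter) (use assms in \<open>auto intro!: sum.cong simp: arcs_from_to_types[OF t]\<close>)
qed (simp_all add: arcs_from_to_types[OF t])

lemma sum_arcs_II:
  fixes F :: "vertex \<Rightarrow> vertex \<times> vertex \<Rightarrow> vertex \<times> vertex \<Rightarrow> vertex \<times> vertex \<Rightarrow> vertex \<times> vertex
    \<Rightarrow> 'a::comm_monoid_add"
  assumes t: "cyclic_types A B C" and "p \<in> levels N" "q \<in> levels N" "p' \<in> levels N" "q' \<in> levels N"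
  shows "(\<Sum>k\<in>verts (Dstar N). \<Sum>\<beta>1\<in>arcs_from_to (Dstar N) (B q) k.
           \<Sum>\<beta>2\<in>arcs_from_to (Dstar N) k (A p). \<Sum>\<beta>3\<in>arcs_from_to (Dstar N) k (A p').
           \<Sum>\<beta>4\<in>arcs_from_to (Dstar N) (B q') k. F k \<beta>1 \<beta>2 \<beta>3 \<beta>4)
       = (\<Sum>r\<in>apexes N p q \<inter> apexes N p' q'.
            F (C r) (B q, C r) (C r, A p) (C r, A p') (B q', C r))"
proof -
  have e: "apexes N p q \<inter> apexes N p' q' =
      {r \<in> levels N. near q r \<and> near r p \<and> near r p' \<and> near q' r}"
    by (auto simp: apexes_def)
  show ?thesis
  proof (subst sum_verts_third_type[OF t])
    show "(\<Sum>r\<in>levels N. \<Sum>\<beta>1\<in>arcs_from_to (Dstar N) (B q) (C r).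
           \<Sum>\<beta>2\<in>arcs_from_to (Dstar N) (C r) (A p). \<Sum>\<beta>3\<in>arcs_from_to (Dstar N) (C r) (A p').
           \<Sum>\<beta>4\<in>arcs_from_to (Dstar N) (B q') (C r). F (C r) \<beta>1 \<beta>2 \<beta>3 \<beta>4)
       = (\<Sum>r\<in>apexes N p q \<inter> apexes N p' q'.
            F (C r) (B q, C r) (C r, A p) (C r, A p') (B q', C r))"
      unfolding e
      by (subst sum.inter_filter) (use assms in \<open>auto intro!: sum.cong simp: arcs_from_to_types[OF t]\<close>)
  qed (simp_all add: arcs_from_to_types[OF t])
qed

lemma ball_arcs_Dstar:
  "(\<forall>i\<in>verts (Dstar N). \<forall>j\<in>verts (Dstar N). \<forall>\<alpha>\<in>arcs_from_to (Dstar N) i j. P i j \<alpha>) \<longleftrightarrow>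
   (\<forall>A B C. cyclic_types A B C \<longrightarrow> (\<forall>p\<in>levels N. \<forall>q\<in>levels N. near p q \<longrightarrow> P (A p) (B q) (A p, B q)))"
   (is "?L \<longleftrightarrow> ?R")
proof
  assume L: ?L
  show ?R
  proof (intro allI impI ballI)
    fix A B C p q assume t: "cyclic_types A B C" and pq: "p \<in> levels N" "q \<in> levels N" "near p q"
    show "P (A p) (B q) (A p, B q)"
      using L pq arcs_from_to_types(1)[OF t, of N p q] by (auto simp: verts_types(1)[OF t])
  qed
next
  assume R: ?R
  show ?L
  proof (intro ballI)
    fix i j \<alpha> assume ij: "i \<in> verts (Dstar N)" "j \<in> verts (Dstar N)"
      and \<alpha>: "\<alpha> \<in> arcs_from_to (Dstar N) i j"
    then obtain A B C l m where t: "cyclic_types A B C" and e: "i = A l" "j = B m"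
      by (auto simp: arcs_from_to_Dstar split: if_splits)
    show "P i j \<alpha>" using \<alpha> R t unfolding e arcs_from_to_types(1)[OF t]
      by (auto split: if_splits)
  qed
qed

lemma type_I_levels:
  "type_I N (Dstar N) (Dstar_phi N) W \<longleftrightarrow>
   (\<forall>A B C. cyclic_types A B C \<longrightarrow> level_I N (\<lambda>p q r. cell_at W (A p) (B q) (C r)))"
proof -
  let ?P = "\<lambda>i j \<alpha>. (\<Sum>k\<in>verts (Dstar N). \<Sum>\<beta>\<in>arcs_from_to (Dstar N) j k.
      \<Sum>\<gamma>\<in>arcs_from_to (Dstar N) k i. W \<alpha> \<beta> \<gamma> * cnj (W \<alpha> \<beta> \<gamma>))
        = of_real (qint N 2 * Dstar_phi N i * Dstar_phi N j)"
  have "type_I N (Dstar N) (Dstar_phi N) W \<longleftrightarrow> (\<forall>i\<in>verts (Dstar N). \<forall>j\<in>verts (Dstar N).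
      \<forall>\<alpha>\<in>arcs_from_to (Dstar N) i j. ?P i j \<alpha>)"
    unfolding type_I_def by (auto simp: arcs_from_to_Dstar)
  also have "\<dots> \<longleftrightarrow> (\<forall>A B C. cyclic_types A B C \<longrightarrow>
      (\<forall>p\<in>levels N. \<forall>q\<in>levels N. near p q \<longrightarrow> ?P (A p) (B q) (A p, B q)))"
    by (rule ball_arcs_Dstar)
  also have "\<dots> \<longleftrightarrow> (\<forall>A B C. cyclic_types A B C \<longrightarrow> level_I N (\<lambda>p q r. cell_at W (A p) (B q) (C r)))"
  proof (intro iff_allI imp_cong refl)
    fix A B C assume t: "cyclic_types A B C"
    have "?P (A p) (B q) (A p, B q) \<longleftrightarrow>
       (\<Sum>r\<in>apexes N p q. (cmod (cell_at W (A p) (B q) (C r)))\<^sup>2)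
         = qint N 2 * level_phi N p * level_phi N q"
      if "p \<in> levels N" "q \<in> levels N" for p q
      unfolding sum_arcs_I[OF t that] level_types[OF t] complex_norm_square[symmetric] cell_at_def
        of_real_sum[symmetric] of_real_eq_iff ..
    then show "(\<forall>p\<in>levels N. \<forall>q\<in>levels N. near p q \<longrightarrow> ?P (A p) (B q) (A p, B q)) \<longleftrightarrow>
       level_I N (\<lambda>p q r. cell_at W (A p) (B q) (C r))"
      unfolding level_I_def by blast
  qed
  finally show ?thesis .
qed

lemma type_II_levels:
  "type_II (Dstar N) (Dstar_phi N) W \<longleftrightarrow>
   (\<forall>A B C. cyclic_types A B C \<longrightarrow> level_II N (\<lambda>p q r. cell_at W (A p) (B q) (C r)))"
  (is "?L \<longleftrightarrow> ?R")
proof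
  assume L: ?L
  show ?R
  proof (intro allI impI)
    fix A B C assume t: "cyclic_types A B C"
    show "level_II N (\<lambda>p q r. cell_at W (A p) (B q) (C r))"
      unfolding level_II_def
    proof (intro ballI impI, elim conjE)
      fix p q p' q' assume l: "p \<in> levels N" "q \<in> levels N" "p' \<in> levels N" "q' \<in> levels N"
        and n: "near p q" "near p' q" "near p' q'" "near p q'"
      have v: "A p \<in> verts (Dstar N)" "B q \<in> verts (Dstar N)" "A p' \<in> verts (Dstar N)"
          "B q' \<in> verts (Dstar N)"
        using l by (auto simp: verts_types(1)[OF t])
      have a: "(A p, B q) \<in> arcs_from_to (Dstar N) (A p) (B q)"
         "(A p', B q) \<in> arcs_from_to (Dstar N) (A p') (B q)"
         "(A p', B q') \<in> arcs_from_to (Dstar N) (A p') (B q')"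
         "(A p, B q') \<in> arcs_from_to (Dstar N) (A p) (B q')"
        using l n by (auto simp: arcs_from_to_types(1)[OF t])
      from L[unfolded type_II_def, THEN bspec, OF v(1), THEN bspec, OF v(2), THEN bspec, OF v(3),
          THEN bspec, OF v(4), THEN bspec, OF a(1), THEN bspec, OF a(2), THEN bspec, OF a(3),
          THEN bspec, OF a(4)]
      show "(\<Sum>r\<in>apexes N p q \<inter> apexes N p' q'. of_real (inverse (level_phi N r))
        * cell_at W (A p) (B q) (C r) * cnj (cell_at W (A p') (B q) (C r))
        * cell_at W (A p') (B q') (C r) * cnj (cell_at W (A p) (B q') (C r)))
     = of_bool (q = q') * of_real (level_phi N p * level_phi N q * level_phi N p')
       + of_bool (p = p') * of_real (level_phi N p * level_phi N q * level_phi N q')"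
        unfolding sum_arcs_II[OF t l] level_types[OF t] cell_at_def prod.inject verts_types(7,8)[OF t]
        by (simp only: simp_thms HOL.refl eq_commute[of p' p] of_bool_idem)
    qed
  qed
next
  assume R: ?R
  show ?L
    unfolding type_II_def
  proof (intro ballI)
    fix i1 i2 i3 i4 \<alpha>1 \<alpha>2 \<alpha>3 \<alpha>4
    assume v: "i1 \<in> verts (Dstar N)" "i2 \<in> verts (Dstar N)" "i3 \<in> verts (Dstar N)"
          "i4 \<in> verts (Dstar N)"
      and a: "\<alpha>1 \<in> arcs_from_to (Dstar N) i1 i2" "\<alpha>2 \<in> arcs_from_to (Dstar N) i3 i2"
      "\<alpha>3 \<in> arcs_from_to (Dstar N) i3 i4" "\<alpha>4 \<in> arcs_from_to (Dstar N) i1 i4"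
    from a(1) obtain A B C p q where t: "cyclic_types A B C" and e: "i1 = A p" "i2 = B q"
      by (auto simp: arcs_from_to_Dstar split: if_splits)
    from a(2) t e obtain p' where e3: "i3 = A p'"
      by (cases i3) (auto simp: arcs_from_to_Dstar cyclic_types_def split: if_splits)
    from a(3) t e3 obtain q' where e4: "i4 = B q'"
      by (cases i4) (auto simp: arcs_from_to_Dstar cyclic_types_def split: if_splits)
    from a have l: "p \<in> levels N" "q \<in> levels N" "p' \<in> levels N" "q' \<in> levels N"
        and n: "near p q" "near p' q" "near p' q'" "near p q'"
        and \<alpha>: "\<alpha>1 = (A p, B q)" "\<alpha>2 = (A p', B q)" "\<alpha>3 = (A p', B q')" "\<alpha>4 = (A p, B q')"
      by (auto simp: arcs_from_to_types(1)[OF t] e e3 e4 split: if_splits)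
    have "level_II N (\<lambda>p q r. cell_at W (A p) (B q) (C r))" using R t by blast
    from this[unfolded level_II_def, THEN bspec, OF l(1), THEN bspec, OF l(2), THEN bspec, OF l(3),
       THEN bspec, OF l(4)] n
    show "(\<Sum>k\<in>verts (Dstar N). \<Sum>\<beta>1\<in>arcs_from_to (Dstar N) i2 k.
       \<Sum>\<beta>2\<in>arcs_from_to (Dstar N) k i1. \<Sum>\<beta>3\<in>arcs_from_to (Dstar N) k i3.
       \<Sum>\<beta>4\<in>arcs_from_to (Dstar N) i4 k.
             of_real (inverse (Dstar_phi N k)) * W \<alpha>1 \<beta>1 \<beta>2 * cnj (W \<alpha>2 \<beta>1 \<beta>3)
               * W \<alpha>3 \<beta>4 \<beta>3 * cnj (W \<alpha>4 \<beta>4 \<beta>2))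
        = of_bool (\<alpha>1 = \<alpha>4) * of_bool (\<alpha>2 = \<alpha>3) * of_real (Dstar_phi N i1 * Dstar_phi N i2 * Dstar_phi N i3)
          + of_bool (\<alpha>1 = \<alpha>2) * of_bool (\<alpha>3 = \<alpha>4) * of_real (Dstar_phi N i1 * Dstar_phi N i2 * Dstar_phi N i4)"
      unfolding e e3 e4 \<alpha> sum_arcs_II[OF t l] level_types[OF t] cell_at_def prod.inject verts_types(7,8)[OF t]
      by (simp only: simp_thms HOL.refl eq_commute[of p' p] of_bool_idem)
  qed
qed

lemma near_commute: "near p q \<longleftrightarrow> near q p"
  by (auto simp: near_def)

lemma apexes_commute: "apexes N p q = apexes N q p"
  by (auto simp: apexes_def near_commute)

lemma apexes_edge:
  assumes "1 \<le> l" "l + 1 < N div 2"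
  shows "apexes N l (l + 1) = {l, l + 1}" "apexes N (l + 1) l = {l, l + 1}"
    "apexes N l l \<inter> apexes N l (l + 1) = {l, l + 1}"
    "apexes N (l + 1) l \<inter> apexes N (l + 1) (l + 1) = {l, l + 1}"
    "apexes N l l \<inter> apexes N (l + 1) (l + 1) = {l, l + 1}"
  using assms by (auto simp: apexes_def levels_def near_def)

lemma apexes_gap:
  assumes "1 \<le> l" "l + 2 < N div 2"
  shows "apexes N (l + 1) l \<inter> apexes N (l + 1) (l + 2) = {l + 1}"
  using assms by (auto simp: apexes_def levels_def near_def)

text \<open>At the two ends of the graph one of the levels \<open>l - 1\<close>, \<open>l + 1\<close> is missing. For the quantities
  below the missing term vanishes, because $[0] = [N] = 0$, so the ends need no separate treatment.\<close>

lemma sum_apexes_diag: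
  fixes F :: "nat \<Rightarrow> 'a::comm_monoid_add"
  assumes l: "1 \<le> l" "l < N div 2"
    and "l = 1 \<Longrightarrow> F 0 = 0" "l + 1 = N div 2 \<Longrightarrow> F (l + 1) = 0"
  shows "(\<Sum>r\<in>apexes N l l. F r) = F (l - 1) + F l + F (l + 1)"
proof -
  have "(\<Sum>r\<in>apexes N l l. F r) = (\<Sum>r\<in>{l - 1, l, l + 1}. F r)"
  proof (rule sum.mono_neutral_left)
    show "\<forall>r\<in>{l - 1, l, l + 1} - apexes N l l. F r = 0"
    proof
      fix r assume "r \<in> {l - 1, l, l + 1} - apexes N l l"
      then have "(r = 0 \<and> l = 1) \<or> (r = l + 1 \<and> l + 1 = N div 2)"
        using l by (auto simp: apexes_def near_def levels_def)
      then show "F r = 0" using assms by auto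
    qed
  qed (auto simp: apexes_def near_def levels_def)
  also have "\<dots> = F (l - 1) + F l + F (l + 1)"
    using l by (cases l) (auto simp: add.assoc)
  finally show ?thesis .
qed

definition triangle :: "nat \<Rightarrow> nat \<Rightarrow> nat \<Rightarrow> nat \<Rightarrow> bool" where
  "triangle N p q r \<longleftrightarrow> p \<in> levels N \<and> q \<in> levels N \<and> r \<in> levels N \<and> near p q \<and> near q r \<and> near r p"

text \<open>Three levels at pairwise distance at most one take at most two values.\<close>

lemma triangle_cases:
  assumes "triangle N p q r"
  obtains (diag) l where "1 \<le> l" "l < N div 2" "p = l" "q = l" "r = l"
  | (step) l where "1 \<le> l" "l + 1 < N div 2"
     "(p, q, r) \<in> {(l, l, l + 1), (l, l + 1, l), (l + 1, l, l),
       (l, l + 1, l + 1), (l + 1, l, l + 1), (l + 1, l + 1, l)}"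
proof -
  define l where "l = min p (min q r)"
  have "(1 \<le> l \<and> l < N div 2 \<and> p = l \<and> q = l \<and> r = l) \<or> (1 \<le> l \<and> l + 1 < N div 2 \<and>
     (p, q, r) \<in> {(l, l, l + 1), (l, l + 1, l), (l + 1, l, l),
       (l, l + 1, l + 1), (l + 1, l, l + 1), (l + 1, l + 1, l)})"
    using assms unfolding l_def triangle_def levels_def near_def
    by (auto simp: min_def split: if_splits)
  then show ?thesis using diag step by blast
qed

text \<open>The values depend only on the multiset of the three levels. Hence one verification covers all three
  types of edges, and $\mathbb{Z}_3$-symmetry is immediate.\<close>

lemma val_ijk_rotate: "val_ijk N s d p q r = val_ijk N s d q r p"
proof -
  define l where "l = min p (min q r)"
  have m: "min q (min r p) = l"
    by (simp add: l_def min.commute min.left_commute)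
  have "(p, q, r) = (l, l, l) \<longleftrightarrow> (q, r, p) = (l, l, l)"
    "(p, q, r) \<in> {(l, l, l + 1), (l, l + 1, l), (l + 1, l, l)}
      \<longleftrightarrow> (q, r, p) \<in> {(l, l, l + 1), (l, l + 1, l), (l + 1, l, l)}"
    "(p, q, r) \<in> {(l, l + 1, l + 1), (l + 1, l, l + 1), (l + 1, l + 1, l)}
      \<longleftrightarrow> (q, r, p) \<in> {(l, l + 1, l + 1), (l + 1, l, l + 1), (l + 1, l + 1, l)}"
    by auto
  then show ?thesis
    unfolding val_ijk_def Let_def m l_def[symmetric] by (simp only:)
qed

lemma val_ijk_swap: "val_ijk N s d p q r = val_ijk N s d q p r"
proof -
  define l where "l = min p (min q r)"
  have m: "min q (min p r) = l"
    by (simp add: l_def min.commute min.left_commute)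
  have "(p, q, r) = (l, l, l) \<longleftrightarrow> (q, p, r) = (l, l, l)"
    "(p, q, r) \<in> {(l, l, l + 1), (l, l + 1, l), (l + 1, l, l)}
      \<longleftrightarrow> (q, p, r) \<in> {(l, l, l + 1), (l, l + 1, l), (l + 1, l, l)}"
    "(p, q, r) \<in> {(l, l + 1, l + 1), (l + 1, l, l + 1), (l + 1, l + 1, l)}
      \<longleftrightarrow> (q, p, r) \<in> {(l, l + 1, l + 1), (l + 1, l, l + 1), (l + 1, l + 1, l)}"
    by auto
  then show ?thesis
    unfolding val_ijk_def Let_def m l_def[symmetric] by (simp only:)
qed

lemma val_ijk_values:
  "val_ijk N s d l l l = d l"
  "val_ijk N s d l l (l + 1) = val_one_up N s l"
  "val_ijk N s d l (l + 1) l = val_one_up N s l"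
  "val_ijk N s d (l + 1) l l = val_one_up N s l"
  "val_ijk N s d l (l + 1) (l + 1) = val_two_up N s l"
  "val_ijk N s d (l + 1) l (l + 1) = val_two_up N s l"
  "val_ijk N s d (l + 1) (l + 1) l = val_two_up N s l"
  by (simp_all add: val_ijk_def Let_def)

section \<open>Quantum integers at a root of unity\<close>

lemma qint_0 [simp]: "qint N 0 = 0"
  by (simp add: qint_sin)

context
  fixes N :: nat
  assumes N: "N \<ge> 4"
begin

private definition t :: real where "t = pi / real N"

private lemma t: "0 < t" "4 * t \<le> pi" "real N * t = pi" "sin t > 0"
  and qt: "qint N m = sin (real m * t) / sin t"
proof -
  show "0 < t" "4 * t \<le> pi" "real N * t = pi"
    using N by (auto simp: t_def field_simps)
  then show "sin t > 0" by (intro sin_gt_zero) auto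
  show "qint N m = sin (real m * t) / sin t" by (simp add: qint_sin t_def)
qed

lemma qint_N: "qint N N = 0"
  by (simp add: qt t(3))

lemma qint_1: "qint N 1 = 1" "qint N (Suc 0) = 1"
  using t(4) by (auto simp: qt)

lemma qint_pos: "0 < m \<Longrightarrow> m < N \<Longrightarrow> qint N m > 0"
  unfolding qint_sin using N
  by (intro divide_pos_pos sin_gt_zero) (auto simp: field_simps)

private lemma qint_2: "qint N 2 = 2 * cos t"
  using t(4) by (simp add: qt sin_double)

lemma qint_add: "qint N m + qint N (m + 2) = qint N 2 * qint N (m + 1)"
proof -
  define x where "x = real (m + 1) * t"
  have "real m * t = x - t" "real (m + 2) * t = x + t"
    by (auto simp: x_def algebra_simps)
  then have "qint N m + qint N (m + 2) = (sin (x - t) + sin (x + t)) / sin t"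
    by (simp add: qt add_divide_distrib)
  then show ?thesis
    unfolding qint_2 qt[of "m + 1"] x_def[symmetric] by (simp add: sin_diff sin_add)
qed

lemma qint_mult: "qint N m * qint N (m + 2) = (qint N (m + 1))\<^sup>2 - 1"
proof -
  define x where "x = real (m + 1) * t"
  have e: "real m * t = x - t" "real (m + 2) * t = x + t"
    by (auto simp: x_def algebra_simps)
  have "sin (x - t) * sin (x + t) = (sin x)\<^sup>2 - (sin t)\<^sup>2"
    using sin_cos_squared_add[of x] sin_cos_squared_add[of t] unfolding sin_diff sin_add by algebra
  then show ?thesis
    unfolding qt e x_def[symmetric] using t(4) by (simp add: field_simps power2_eq_square)
qed

private lemma qint_diff: "1 \<le> l \<Longrightarrow> qint N (2 * l + 1) - qint N (2 * l - 1) = 2 * cos (real (2 * l) * t)"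
proof -
  assume l: "1 \<le> l"
  have e: "real (2 * l - 1) * t = real (2 * l) * t - t" "real (2 * l + 1) * t = real (2 * l) * t + t"
    using l by (auto simp: algebra_simps of_nat_diff)
  show ?thesis
    unfolding qt e sin_diff sin_add using t(4) by (simp add: field_simps)
qed

text \<open>With $\theta = 2l\pi/N$ the second factor is $2\cos\theta$, and the claim is $\sin 2\theta = 2\sin\theta\cos\theta$.\<close>

lemma qint_4:
  assumes "1 \<le> l"
  shows "qint N (4 * l) = qint N (2 * l) * (qint N (2 * l + 1) - qint N (2 * l - 1))"
proof -
  have "real (4 * l) * t = 2 * (real (2 * l) * t)" by simp
  then have "qint N (4 * l) = sin (2 * (real (2 * l) * t)) / sin t" by (metis qt)
  then show ?thesis
    unfolding qint_diff[OF assms] qt[of "2 * l"] sin_double by simp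
qed

text \<open>The excess of $[m]^2$ over 1 is the product of the two neighbours of $[m]$, which are positive.\<close>

lemma qint_gt_1:
  assumes "1 < m" "m + 1 < N"
  shows "qint N m > 1"
proof -
  obtain k where k: "m = k + 1" "0 < k" using assms by (metis add.commute less_imp_add_positive)
  have "0 < qint N k * qint N (k + 2)"
    using qint_pos[of k] qint_pos[of "k + 2"] assms k by simp
  then have "1\<^sup>2 < (qint N m)\<^sup>2" unfolding qint_mult k by simp
  then show ?thesis
    by (rule power2_less_imp_less) (use qint_pos[of m] assms in simp)
qed

text \<open>The difference is $2\cos(2l\pi/N)$, which has smaller modulus than $[2] = 2\cos(\pi/N)$ because
  $2l\pi/N$ lies strictly between $\pi/N$ and $\pi - \pi/N$.\<close>

lemma qint_diff_less:
  assumes "1 \<le> l" "2 * l + 1 < N"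
  shows "\<bar>qint N (2 * l + 1) - qint N (2 * l - 1)\<bar> < qint N 2"
proof -
  define x where "x = real (2 * l) * t"
  have "1 * t < x" using t(1) assms unfolding x_def by (intro mult_strict_right_mono) auto
  moreover have "x < pi - t"
  proof -
    have "real (2 * l + 1) * t < real N * t" using assms t(1) by (intro mult_strict_right_mono) auto
    then show ?thesis unfolding x_def t(3) by (simp add: algebra_simps)
  qed
  ultimately have "cos x < cos t" "- cos t < cos x"
    using cos_monotone_0_pi[of t x] cos_monotone_0_pi[of x "pi - t"] t by (auto)
  then show ?thesis unfolding qint_diff[OF assms(1)] qint_2 x_def by auto
qed

lemma qint_reflect: "m \<le> 2 * N \<Longrightarrow> qint N (2 * N - m) = - qint N m"
proof -
  assume m: "m \<le> 2 * N"
  have "real (2 * N - m) * t = 2 * pi - real m * t"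
    using m t(3) by (simp add: of_nat_diff algebra_simps)
  then show ?thesis unfolding qt by (simp add: sin_diff)
qed

end

section \<open>Squared moduli of the two solutions\<close>

text \<open>The formula for the diagonal value that covers all cases of both parts of the theorem.\<close>

definition diag_cell :: "nat \<Rightarrow> real \<Rightarrow> nat \<Rightarrow> real" where
  "diag_cell N s l = (-1) ^ (l + 1)
     * (sqrt (qint N (2 * l)) / (qint N 2 * sqrt (qint N (2 * l - 1) * qint N (2 * l + 1))))
     * sqrt (qint N 2 * qint N (2 * l) + s * qint N (4 * l))"

locale even_Dstar =
  fixes N :: nat and s :: real
  assumes even: "even N" and N4: "N \<ge> 4" and sign: "s = 1 \<or> s = -1"
begin

abbreviation \<phi> :: "nat \<Rightarrow> real" where "\<phi> l \<equiv> qint N (2 * l) / qint N 2"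

lemma s_square: "s * s = 1" "s\<^sup>2 = 1"
  using sign by auto

lemma level_bound: "l < N div 2 \<Longrightarrow> 2 * l + 2 \<le> N"
  using even by auto

lemma qint_2_pos: "qint N 2 > 0"
  using N4 by (intro qint_pos) auto

lemma phi_pos: "1 \<le> l \<Longrightarrow> l < N div 2 \<Longrightarrow> \<phi> l > 0"
  using N4 level_bound[of l] qint_2_pos by (intro divide_pos_pos qint_pos) auto

text \<open>The radicand is $[2l]$ times $[2] \pm ([2l+1]-[2l-1])$.\<close>

lemma diag_radicand_pos:
  assumes "1 \<le> l" "l < N div 2"
  shows "qint N 2 * qint N (2 * l) + s * qint N (4 * l) > 0"
proof -
  have b: "2 * l + 1 < N" using level_bound assms by fastforce
  have "qint N 2 + s * (qint N (2 * l + 1) - qint N (2 * l - 1)) > 0"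
    using qint_diff_less[OF N4 assms(1) b] sign by auto
  moreover have "qint N (2 * l) > 0" using N4 b assms by (intro qint_pos) auto
  ultimately have "qint N (2 * l) * (qint N 2 + s * (qint N (2 * l + 1) - qint N (2 * l - 1))) > 0"
    by simp
  then show ?thesis unfolding qint_4[OF N4 assms(1)] by (simp add: algebra_simps)
qed

text \<open>The squares of the values on the triangles of levels $(l,l,l+1)$, $(l,l+1,l+1)$ and $(l,l,l)$.\<close>

definition one_sq where
  "one_sq l = qint N (2 * l) * qint N (2 * l + 2) * (qint N (2 * l) - s) / ((qint N 2)\<^sup>2 * qint N (2 * l + 1))"
definition two_sq where
  "two_sq l = qint N (2 * l) * qint N (2 * l + 2) * (qint N (2 * l + 2) + s) / ((qint N 2)\<^sup>2 * qint N (2 * l + 1))"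
definition diag_sq where
  "diag_sq l = qint N (2 * l) * (qint N 2 * qint N (2 * l) + s * qint N (4 * l)) /
     ((qint N 2)\<^sup>2 * qint N (2 * l - 1) * qint N (2 * l + 1))"

lemma qint_even_gt_1: "1 \<le> l \<Longrightarrow> l < N div 2 \<Longrightarrow> qint N (2 * l) > 1"
proof -
  assume "1 \<le> l" "l < N div 2"
  then show ?thesis using level_bound[of l] N4 by (intro qint_gt_1) auto
qed

lemma qint_nonneg: "m \<le> N \<Longrightarrow> qint N m \<ge> 0"
  using qint_pos[OF N4, of m] qint_N[OF N4] by (cases "m = 0 \<or> m = N") auto

lemma val_one_up_square: "1 \<le> l \<Longrightarrow> l < N div 2 \<Longrightarrow> (val_one_up N s l)\<^sup>2 = one_sq l"
proof -
  assume l: "1 \<le> l" "l < N div 2"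
  have "qint N (2 * l) - s \<ge> 0" using qint_even_gt_1[OF l] sign by auto
  moreover have "0 \<le> qint N (2 * l) * qint N (2 * l + 2)" "0 \<le> qint N (2 * l + 1)"
    using level_bound[OF l(2)] by (auto intro!: mult_nonneg_nonneg qint_nonneg)
  ultimately show ?thesis
    by (simp add: val_one_up_def one_sq_def power_mult_distrib power_divide qint_1[OF N4])
qed

lemma val_two_up_square: "l + 1 < N div 2 \<Longrightarrow> (val_two_up N s l)\<^sup>2 = two_sq l"
proof -
  assume l: "l + 1 < N div 2"
  have "qint N (2 * (l + 1)) + s \<ge> 0" using qint_even_gt_1[of "l + 1"] l sign by auto
  moreover have "0 \<le> qint N (2 * l) * qint N (2 * l + 2)" "0 \<le> qint N (2 * l + 1)"
    using level_bound[OF l] by (auto intro!: mult_nonneg_nonneg qint_nonneg)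
  ultimately show ?thesis
    by (simp add: val_two_up_def two_sq_def power_mult_distrib power_divide qint_1[OF N4])
qed

lemma diag_cell_square: "1 \<le> l \<Longrightarrow> l < N div 2 \<Longrightarrow> (diag_cell N s l)\<^sup>2 = diag_sq l"
proof -
  assume l: "1 \<le> l" "l < N div 2"
  have "0 \<le> qint N (2 * l - 1) * qint N (2 * l + 1)" "0 \<le> qint N (2 * l)"
    using level_bound[OF l(2)] by (auto intro!: mult_nonneg_nonneg qint_nonneg)
  then show ?thesis using diag_radicand_pos[OF l]
    by (simp add: diag_cell_def diag_sq_def power_mult_distrib power_divide power_mult[symmetric]
        power_add mult.assoc)
qed

lemma val_one_up_pos: "1 \<le> l \<Longrightarrow> l + 1 < N div 2 \<Longrightarrow> val_one_up N s l > 0"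
proof -
  assume l: "1 \<le> l" "l + 1 < N div 2"
  have "qint N (2 * l) - s > 0" using qint_even_gt_1[of l] l sign by auto
  then show ?thesis using level_bound[OF l(2)] l(1) qint_2_pos unfolding val_one_up_def
    by (auto intro!: mult_pos_pos divide_pos_pos qint_pos[OF N4] simp: qint_1[OF N4])
qed

lemma val_two_up_pos: "1 \<le> l \<Longrightarrow> l + 1 < N div 2 \<Longrightarrow> val_two_up N s l > 0"
proof -
  assume l: "1 \<le> l" "l + 1 < N div 2"
  have "qint N (2 * l + 2) + s > 0" using qint_even_gt_1[of "l + 1"] l sign by auto
  then show ?thesis using level_bound[OF l(2)] l(1) qint_2_pos unfolding val_two_up_def
    by (auto intro!: mult_pos_pos divide_pos_pos qint_pos[OF N4] simp: qint_1[OF N4])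
qed

lemma diag_cell_pos: "1 \<le> l \<Longrightarrow> l < N div 2 \<Longrightarrow> (-1) ^ (l + 1) * diag_cell N s l > 0"
proof -
  assume l: "1 \<le> l" "l < N div 2"
  have "0 < qint N (2 * l - 1)" "0 < qint N (2 * l + 1)" "0 < qint N (2 * l)"
    using level_bound[OF l(2)] l(1) by (auto intro!: qint_pos[OF N4])
  then have "0 < (sqrt (qint N (2 * l)) / (qint N 2 * sqrt (qint N (2 * l - 1) * qint N (2 * l + 1))))
     * sqrt (qint N 2 * qint N (2 * l) + s * qint N (4 * l))"
    using diag_radicand_pos[OF l] qint_2_pos
    by (intro mult_pos_pos divide_pos_pos) auto
  moreover have "(-1) ^ (l + 1) * ((-1) ^ (l + 1) * x) = (x :: real)" for x
    by (simp add: mult.assoc[symmetric] power_add[symmetric] mult_2[symmetric])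
  ultimately show ?thesis unfolding diag_cell_def mult.assoc by simp
qed

text \<open>The two relations for consecutive quantum integers, $[m-1]+[m+1]=[2][m]$ and $[m-1][m+1]=[m]^2-1$,
  around level \<open>l\<close>. Naming the five quantum integers turns what follows into polynomial algebra.\<close>

lemma level_quantities:
  assumes "1 \<le> l" "l < N div 2"
  obtains D V U X Z Y where
    "D = qint N 2" "V = qint N (2 * (l - 1))" "U = qint N (2 * l - 1)" "X = qint N (2 * l)"
    "Z = qint N (2 * l + 1)" "Y = qint N (2 * l + 2)"
    "D > 0" "V \<ge> 0" "U > 0" "X > 1" "Z > 0" "Y \<ge> 0"
    "V + X = D * U" "U + Z = D * X" "X + Y = D * Z"
    "V * X = U\<^sup>2 - 1" "U * Z = X\<^sup>2 - 1" "X * Y = Z\<^sup>2 - 1"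
proof -
  obtain k where l: "l = k + 1" using assms(1) by (metis add.commute le_Suc_ex plus_1_eq_Suc)
  have b: "2 * k + 4 \<le> N" using level_bound[OF assms(2)] l by simp
  show ?thesis
  proof (rule that[OF refl refl refl refl refl refl])
    show "qint N 2 > 0" by (rule qint_2_pos)
    show "qint N (2 * (l - 1)) \<ge> 0" "qint N (2 * l + 2) \<ge> 0" using b l by (auto intro!: qint_nonneg)
    show "qint N (2 * l - 1) > 0" "qint N (2 * l + 1) > 0" using b l by (auto intro!: qint_pos[OF N4])
    show "qint N (2 * l) > 1" using qint_even_gt_1 assms by auto
    show "qint N (2 * (l - 1)) + qint N (2 * l) = qint N 2 * qint N (2 * l - 1)"
      "qint N (2 * l - 1) + qint N (2 * l + 1) = qint N 2 * qint N (2 * l)"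
      "qint N (2 * l) + qint N (2 * l + 2) = qint N 2 * qint N (2 * l + 1)"
      using qint_add[OF N4, of "2 * k"] qint_add[OF N4, of "2 * k + 1"] qint_add[OF N4, of "2 * k + 2"] l
      by (simp_all add: numeral_eq_Suc)
    show "qint N (2 * (l - 1)) * qint N (2 * l) = (qint N (2 * l - 1))\<^sup>2 - 1"
      "qint N (2 * l - 1) * qint N (2 * l + 1) = (qint N (2 * l))\<^sup>2 - 1"
      "qint N (2 * l) * qint N (2 * l + 2) = (qint N (2 * l + 1))\<^sup>2 - 1"
      using qint_mult[OF N4, of "2 * k"] qint_mult[OF N4, of "2 * k + 1"] qint_mult[OF N4, of "2 * k + 2"] l
      by (simp_all add: numeral_eq_Suc)
  qed
qed

text \<open>Since $[2l-1][2l+1] = [2l]^2-1$, these two are inverse to each other. They linearise the squared moduli: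
  those at level \<open>l\<close>, multiplied by $[2]^2$, are polynomials in quantum integers that are linear in
  \<open>rho l\<close> and \<open>sig l\<close>.\<close>

definition rho where "rho l = (qint N (2 * l) - s) / qint N (2 * l + 1)"
definition sig where "sig l = (qint N (2 * l) + s) / qint N (2 * l - 1)"

lemma level_facts:
  assumes "1 \<le> l" "l < N div 2"
  obtains D V U X Z Y where
    "D = qint N 2" "V = qint N (2 * (l - 1))" "U = qint N (2 * l - 1)" "X = qint N (2 * l)"
    "Z = qint N (2 * l + 1)" "Y = qint N (2 * l + 2)"
    "D > 0" "V \<ge> 0" "U > 0" "X > 1" "Z > 0" "Y \<ge> 0"
    "V + X = D * U" "U + Z = D * X" "X + Y = D * Z"
    "V * X = U\<^sup>2 - 1" "U * Z = X\<^sup>2 - 1" "X * Y = Z\<^sup>2 - 1"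
    "Z * rho l = X - s" "U * sig l = X + s" "rho l * sig l = 1"
    "(X - s) * sig l = Z" "(X + s) * rho l = U"
    "(V + s) * sig l = U + s * D" "(Y - s) * rho l = Z - s * D"
    "D\<^sup>2 * one_sq l = X * Y * rho l" "D\<^sup>2 * two_sq (l - 1) = V * X * sig l"
    "D\<^sup>2 * diag_sq l = s * X * (sig l - rho l)"
proof -
  from level_quantities[OF assms] obtain D V U X Z Y where
    d: "D = qint N 2" "V = qint N (2 * (l - 1))" "U = qint N (2 * l - 1)" "X = qint N (2 * l)"
    "Z = qint N (2 * l + 1)" "Y = qint N (2 * l + 2)" and
    p: "D > 0" "V \<ge> 0" "U > 0" "X > 1" "Z > 0" "Y \<ge> 0" and
    e: "V + X = D * U" "U + Z = D * X" "X + Y = D * Z"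
    "V * X = U\<^sup>2 - 1" "U * Z = X\<^sup>2 - 1" "X * Y = Z\<^sup>2 - 1" .
  have r: "Z * rho l = X - s" "U * sig l = X + s"
    using p by (auto simp: rho_def sig_def d)
  have "U * Z * (rho l * sig l) = (Z * rho l) * (U * sig l)" by (simp add: algebra_simps)
  also have "\<dots> = U * Z * 1" unfolding r e using s_square by (simp add: algebra_simps power2_eq_square)
  finally have rs: "rho l * sig l = 1" using p by simp
  have "U * ((X - s) * sig l) = U * Z"
    using r(2) e(5) s_square by algebra
  then have 1: "(X - s) * sig l = Z" using p by simp
  have "Z * ((X + s) * rho l) = Z * U"
    using r(1) e(5) s_square by algebra
  then have 2: "(X + s) * rho l = U" using p by simp
  have "U * ((V + s) * sig l) = U * (U + s * D)"
    using r(2) e(1) e(4) s_square by algebra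
  then have 3: "(V + s) * sig l = U + s * D" using p by simp
  have "Z * ((Y - s) * rho l) = Z * (Z - s * D)"
    using r(1) e(3) e(6) s_square by algebra
  then have 4: "(Y - s) * rho l = Z - s * D" using p by simp
  have b: "D\<^sup>2 * one_sq l = X * Y * rho l"
    using p unfolding one_sq_def rho_def d[symmetric] by simp
  have l2: "2 * (l - 1) + 2 = 2 * l" "2 * (l - 1) + 1 = 2 * l - 1" using assms by auto
  have c: "D\<^sup>2 * two_sq (l - 1) = V * X * sig l"
    using p unfolding two_sq_def sig_def l2 d[symmetric] by simp
  have "D\<^sup>2 * diag_sq l = X * (D * X + s * (X * (Z - U))) / (U * Z)"
    using p unfolding diag_sq_def qint_4[OF N4 assms(1)] d[symmetric] by simp
  also have "\<dots> = s * X * (sig l - rho l)"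
  proof -
    have "D * X + s * (X * (Z - U)) = s * ((X + s) * Z - (X - s) * U)"
      using e(2) s_square by algebra
    also have "\<dots> = s * (U * sig l * Z - Z * rho l * U)" unfolding r ..
    also have "\<dots> = s * (U * Z * (sig l - rho l))" by (simp add: algebra_simps)
    finally show ?thesis using p by simp
  qed
  finally have a: "D\<^sup>2 * diag_sq l = s * X * (sig l - rho l)" .
  show ?thesis by (rule that) (fact d p e r rs 1 2 3 4 a b c)+
qed

text \<open>After division by $[2l]/[2]^2$ the claim is $([2l-2]+s)\,\sigma + ([2l+2]-s)\,\rho = [2][2l]$; the two
  summands are $[2l-1]+s[2]$ and $[2l+1]-s[2]$.\<close>

lemma sq_type_I_diag:
  assumes "1 \<le> l" "l < N div 2"
  shows "two_sq (l - 1) + diag_sq l + one_sq l = qint N 2 * \<phi> l * \<phi> l"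
proof -
  from level_facts[OF assms] obtain D V U X Z Y where
    d: "D = qint N 2" "X = qint N (2 * l)" and
    f: "D > 0" "U + Z = D * X" "(V + s) * sig l = U + s * D" "(Y - s) * rho l = Z - s * D"
    "D\<^sup>2 * one_sq l = X * Y * rho l" "D\<^sup>2 * two_sq (l - 1) = V * X * sig l"
    "D\<^sup>2 * diag_sq l = s * X * (sig l - rho l)" .
  have "D\<^sup>2 * (two_sq (l - 1) + diag_sq l + one_sq l) = D * X\<^sup>2"
    using f(2-) by algebra
  then have "D * (D * (two_sq (l - 1) + diag_sq l + one_sq l)) = D * X\<^sup>2"
    by (simp only: power2_eq_square mult.assoc)
  then have "D * (two_sq (l - 1) + diag_sq l + one_sq l) = X\<^sup>2"
    using f(1) by simp
  then show ?thesis unfolding d[symmetric] using f(1) by (simp add: field_simps power2_eq_square)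
qed

text \<open>Multiplied by $[2]^3/[2l]$, the left-hand side is
  $([2l-1]^2-1)\sigma^2 + (\sigma-\rho)^2 + ([2l+1]^2-1)\rho^2$, in which the squares of
  $[2l-1]\sigma = [2l]+s$ and $[2l+1]\rho = [2l]-s$ survive. At the ends of the graph the inverse of
  $0$ is $0$ and is multiplied by $0$.\<close>

lemma sq_type_II_diag:
  assumes "1 \<le> l" "l < N div 2"
  shows "inverse (\<phi> (l - 1)) * (two_sq (l - 1))\<^sup>2 + inverse (\<phi> l) * (diag_sq l)\<^sup>2
    + inverse (\<phi> (l + 1)) * (one_sq l)\<^sup>2 = 2 * (\<phi> l)^3"
proof -
  from level_facts[OF assms] obtain D V U X Z Y where
    d: "D = qint N 2" "V = qint N (2 * (l - 1))" "U = qint N (2 * l - 1)" "X = qint N (2 * l)"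
    "Z = qint N (2 * l + 1)" "Y = qint N (2 * l + 2)" and
    f: "D > 0" "X > 1" and g: "V * X = U\<^sup>2 - 1" "X * Y = Z\<^sup>2 - 1"
    "Z * rho l = X - s" "U * sig l = X + s" "rho l * sig l = 1"
    and h: "D\<^sup>2 * one_sq l = X * Y * rho l" "D\<^sup>2 * two_sq (l - 1) = V * X * sig l"
    "D\<^sup>2 * diag_sq l = s * X * (sig l - rho l)" .
  have w: "inverse (v / D) * x\<^sup>2 = v * y\<^sup>2 / D ^ 3" if "D\<^sup>2 * x = v * y" for v x y
  proof (cases "v = 0")
    case False
    have x: "x = v * y / D\<^sup>2" using that f by (simp add: field_simps)
    show ?thesis unfolding x using f False by (simp add: field_simps eval_nat_numeral)
  qed (use that f in simp)
  have 1: "inverse (V / D) * (two_sq (l - 1))\<^sup>2 = V * X\<^sup>2 * (sig l)\<^sup>2 / D ^ 3"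
    using w[of "two_sq (l - 1)" V "X * sig l"] h(2) by (simp add: power_mult_distrib mult.assoc)
  have 2: "inverse (Y / D) * (one_sq l)\<^sup>2 = Y * X\<^sup>2 * (rho l)\<^sup>2 / D ^ 3"
    using w[of "one_sq l" Y "X * rho l"] h(1) by (simp add: power_mult_distrib mult_ac)
  have 3: "inverse (X / D) * (diag_sq l)\<^sup>2 = X * (sig l - rho l)\<^sup>2 / D ^ 3"
    using w[of "diag_sq l" X "s * (sig l - rho l)"] h(3)
    by (simp add: power_mult_distrib s_square mult_ac)
  have l2: "2 * (l + 1) = 2 * l + 2" by simp
  have "V * X\<^sup>2 * (sig l)\<^sup>2 + X * (sig l - rho l)\<^sup>2 + Y * X\<^sup>2 * (rho l)\<^sup>2 = 2 * X ^ 3"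
    using g s_square by algebra
  then have "V * X\<^sup>2 * (sig l)\<^sup>2 / D ^ 3 + X * (sig l - rho l)\<^sup>2 / D ^ 3 + Y * X\<^sup>2 * (rho l)\<^sup>2 / D ^ 3
     = 2 * (X / D) ^ 3"
    by (simp add: add_divide_distrib[symmetric] power_divide)
  then show ?thesis unfolding d(1,2,4)[symmetric] 1 3 l2 d(6)[symmetric] 2 .
qed

text \<open>The factors $\sigma_l$ and $\rho_l$ cancel.\<close>

lemma sq_type_II_gap:
  assumes "1 \<le> l" "l < N div 2"
  shows "two_sq (l - 1) * one_sq l = (\<phi> l)\<^sup>2 * \<phi> (l - 1) * \<phi> (l + 1)"
proof -
  from level_facts[OF assms] obtain D V U X Z Y where
    d: "D = qint N 2" "V = qint N (2 * (l - 1))" "U = qint N (2 * l - 1)" "X = qint N (2 * l)"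
    "Z = qint N (2 * l + 1)" "Y = qint N (2 * l + 2)" and
    f: "D > 0" and g: "rho l * sig l = 1"
    and h: "D\<^sup>2 * one_sq l = X * Y * rho l" "D\<^sup>2 * two_sq (l - 1) = V * X * sig l" .
  have l2: "2 * (l + 1) = 2 * l + 2" by simp
  have "D ^ 4 * (two_sq (l - 1) * one_sq l) = X\<^sup>2 * V * Y"
    using g h by algebra
  then show ?thesis unfolding d(1,2,4)[symmetric] l2 d(6)[symmetric]
    using f by (simp add: field_simps eval_nat_numeral)
qed

text \<open>The pair of levels \<open>l\<close>, \<open>l + 1\<close> meets in the quantum integer $[2l+1]$, the denominator of both
  $\rho_l$ and $\sigma_{l+1}$.\<close>

lemma step_facts:
  assumes "1 \<le> l" "l + 1 < N div 2"
  obtains D X Z Y where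
    "D = qint N 2" "X = qint N (2 * l)" "Y = qint N (2 * (l + 1))"
    "D > 0" "X > 0" "Z > 0" "Y > 0"
    "X + Y = D * Z" "X * Y = Z\<^sup>2 - 1"
    "Z * rho l = X - s" "rho l * sig l = 1" "(X - s) * sig l = Z"
    "Z * sig (l + 1) = Y + s" "rho (l + 1) * sig (l + 1) = 1" "(Y + s) * rho (l + 1) = Z"
    "one_sq l = X * Y * rho l / D\<^sup>2" "two_sq l = X * Y * sig (l + 1) / D\<^sup>2"
    "diag_sq l = s * X * (sig l - rho l) / D\<^sup>2"
    "diag_sq (l + 1) = s * Y * (sig (l + 1) - rho (l + 1)) / D\<^sup>2"
proof -
  have "l < N div 2" using assms by simp
  from level_facts[OF assms(1) this] obtain D V U X Z Y where
    d: "D = qint N 2" "X = qint N (2 * l)"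
    "Z = qint N (2 * l + 1)" "Y = qint N (2 * l + 2)" and
    p: "D > 0" "X > 1" "Z > 0" and
    e: "X + Y = D * Z" "X * Y = Z\<^sup>2 - 1"
    "Z * rho l = X - s" "rho l * sig l = 1" "(X - s) * sig l = Z"
    "D\<^sup>2 * one_sq l = X * Y * rho l"
    "D\<^sup>2 * diag_sq l = s * X * (sig l - rho l)" .
  have "1 \<le> l + 1" by simp
  from level_facts[OF this assms(2)] obtain D' V' U' X' where
    d': "D' = qint N 2" "V' = qint N (2 * (l + 1 - 1))" "U' = qint N (2 * (l + 1) - 1)" "X' = qint N (2 * (l + 1))"
    and p': "X' > 1" and
    e': "U' * sig (l + 1) = X' + s" "rho (l + 1) * sig (l + 1) = 1" "(X' + s) * rho (l + 1) = U'"
    "D'\<^sup>2 * two_sq (l + 1 - 1) = V' * X' * sig (l + 1)"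
    "D'\<^sup>2 * diag_sq (l + 1) = s * X' * (sig (l + 1) - rho (l + 1))" .
  have i: "D' = D" "V' = X" "U' = Z" "X' = Y" using d d' by simp_all
  have div: "x = w / D\<^sup>2" if "D\<^sup>2 * x = w" for x w
    using that p by auto
  have two: "D\<^sup>2 * two_sq l = X * Y * sig (l + 1)" using e'(4) unfolding i by simp
  show ?thesis
  proof (rule that[of D X Y Z])
    show "Y = qint N (2 * (l + 1))" "Y > 0" using d'(4) p' unfolding i by auto
    show "X > 0" using p by simp
    show "Z * sig (l + 1) = Y + s" "(Y + s) * rho (l + 1) = Z" using e' unfolding i by auto
    show "diag_sq (l + 1) = s * Y * (sig (l + 1) - rho (l + 1)) / D\<^sup>2"
      using e'(5) unfolding i by (rule div)
  qed (fact d p e e'(2) div[OF e(6)] div[OF e(7)] div[OF two])+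
qed

lemma sq_type_I_step:
  assumes "1 \<le> l" "l + 1 < N div 2"
  shows "one_sq l + two_sq l = qint N 2 * \<phi> l * \<phi> (l + 1)"
proof -
  from step_facts[OF assms] obtain D X Z Y where
    d: "D = qint N 2" "X = qint N (2 * l)" "Y = qint N (2 * (l + 1))" and
    p: "D > 0" "X > 0" "Z > 0" "Y > 0" and e: "X + Y = D * Z" "Z * rho l = X - s" "Z * sig (l + 1) = Y + s"
    and h: "one_sq l = X * Y * rho l / D\<^sup>2" "two_sq l = X * Y * sig (l + 1) / D\<^sup>2" .
  have "Z * (rho l + sig (l + 1)) = Z * D" using e by algebra
  then have "rho l + sig (l + 1) = D" using p by simp
  then have "X * Y * rho l + X * Y * sig (l + 1) = X * Y * D"
    by (simp add: distrib_left[symmetric])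
  then show ?thesis unfolding d[symmetric] h add_divide_distrib[symmetric]
    using p by (simp add: field_simps power2_eq_square)
qed

text \<open>The last equation makes the two terms of type II on a nondegenerate square have equal moduli;
  it amounts to $[2l+2](1-\rho_l^2) = [2l](\sigma_{l+1}^2-1)$.\<close>

lemma sq_type_II_step:
  assumes "1 \<le> l" "l + 1 < N div 2"
  shows "inverse (\<phi> l) * (one_sq l)\<^sup>2 + inverse (\<phi> (l + 1)) * (two_sq l)\<^sup>2
     = \<phi> l * \<phi> (l + 1) * (\<phi> l + \<phi> (l + 1))"
    and "inverse (\<phi> l) * (diag_sq l * one_sq l) + inverse (\<phi> (l + 1)) * (one_sq l * two_sq l)
     = (\<phi> l)\<^sup>2 * \<phi> (l + 1)"
    and "inverse (\<phi> l) * (one_sq l * two_sq l) + inverse (\<phi> (l + 1)) * (two_sq l * diag_sq (l + 1))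
     = \<phi> l * (\<phi> (l + 1))\<^sup>2"
    and "one_sq l * diag_sq l / (\<phi> l)\<^sup>2 = two_sq l * diag_sq (l + 1) / (\<phi> (l + 1))\<^sup>2"
proof -
  from step_facts[OF assms] obtain D X Z Y where
    d: "D = qint N 2" "X = qint N (2 * l)" "Y = qint N (2 * (l + 1))" and
    p: "D > 0" "X > 0" "Z > 0" "Y > 0" and e:
    "X + Y = D * Z" "X * Y = Z\<^sup>2 - 1"
    "Z * rho l = X - s" "rho l * sig l = 1" "(X - s) * sig l = Z"
    "Z * sig (l + 1) = Y + s" "rho (l + 1) * sig (l + 1) = 1" "(Y + s) * rho (l + 1) = Z"
    and h: "one_sq l = X * Y * rho l / D\<^sup>2" "two_sq l = X * Y * sig (l + 1) / D\<^sup>2"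
    "diag_sq l = s * X * (sig l - rho l) / D\<^sup>2"
    "diag_sq (l + 1) = s * Y * (sig (l + 1) - rho (l + 1)) / D\<^sup>2" .
  define r t r' t' where "r = rho l" "t = sig l" "r' = rho (l + 1)" "t' = sig (l + 1)"
  note rt = this[symmetric]
  note e = e[unfolded rt] and h = h[unfolded rt]
  have "Z\<^sup>2 * (Y * r\<^sup>2 + X * t'\<^sup>2) = Z\<^sup>2 * (X + Y)"
    using e(2,3,6) s_square by algebra
  then have 1: "Y * r\<^sup>2 + X * t'\<^sup>2 = X + Y" using p by simp
  have "inverse (X / D) * (X * Y * r / D\<^sup>2)\<^sup>2 + inverse (Y / D) * (X * Y * t' / D\<^sup>2)\<^sup>2
     = X * Y * (Y * r\<^sup>2 + X * t'\<^sup>2) / D ^ 3"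
    using p by (simp add: field_simps eval_nat_numeral)
  also have "\<dots> = X / D * (Y / D) * (X / D + Y / D)"
    unfolding 1 using p by (simp add: field_simps eval_nat_numeral)
  finally show "inverse (\<phi> l) * (one_sq l)\<^sup>2 + inverse (\<phi> (l + 1)) * (two_sq l)\<^sup>2
     = \<phi> l * \<phi> (l + 1) * (\<phi> l + \<phi> (l + 1))"
    unfolding d[symmetric] h .
  have "Z * (s * (t - r) + X * t') = Z * (X * t)"
    using e(2,3,5,6) s_square by algebra
  then have 2: "s * (t - r) + X * t' = X * t" using p by simp
  have "inverse (X / D) * (s * X * (t - r) / D\<^sup>2 * (X * Y * r / D\<^sup>2))
      + inverse (Y / D) * (X * Y * r / D\<^sup>2 * (X * Y * t' / D\<^sup>2))
     = X * Y * (r * (s * (t - r) + X * t')) / D ^ 3"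
    using p by (simp add: field_simps eval_nat_numeral)
  also have "r * (s * (t - r) + X * t') = X"
    unfolding 2 using e(4) by algebra
  finally show "inverse (\<phi> l) * (diag_sq l * one_sq l) + inverse (\<phi> (l + 1)) * (one_sq l * two_sq l)
     = (\<phi> l)\<^sup>2 * \<phi> (l + 1)"
    unfolding d[symmetric] h using p by (simp add: field_simps eval_nat_numeral)
  have "Z * (Y * r + s * (t' - r')) = Z * (Y * r')"
    using e(2,3,6,8) s_square by algebra
  then have 3: "Y * r + s * (t' - r') = Y * r'" using p by simp
  have "inverse (X / D) * (X * Y * r / D\<^sup>2 * (X * Y * t' / D\<^sup>2))
      + inverse (Y / D) * (X * Y * t' / D\<^sup>2 * (s * Y * (t' - r') / D\<^sup>2))
     = X * Y * (t' * (Y * r + s * (t' - r'))) / D ^ 3"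
    using p by (simp add: field_simps eval_nat_numeral)
  also have "t' * (Y * r + s * (t' - r')) = Y"
    unfolding 3 using e(7) by algebra
  finally show "inverse (\<phi> l) * (one_sq l * two_sq l) + inverse (\<phi> (l + 1)) * (two_sq l * diag_sq (l + 1))
     = \<phi> l * (\<phi> (l + 1))\<^sup>2"
    unfolding d[symmetric] h using p by (simp add: field_simps eval_nat_numeral)
  have "Z\<^sup>2 * (Y * (1 - r\<^sup>2)) = Z\<^sup>2 * (X * (t'\<^sup>2 - 1))"
    using e(2,3,6) s_square by algebra
  then have "Y * (1 - r\<^sup>2) = X * (t'\<^sup>2 - 1)" using p by simp
  then have "s * (Y * (r * (t - r))) = s * (X * (t' * (t' - r')))"
    using e(4,7) by algebra
  moreover have "X * Y * r / D\<^sup>2 * (s * X * (t - r) / D\<^sup>2) / (X / D)\<^sup>2 = s * (Y * (r * (t - r))) / D\<^sup>2"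
    "X * Y * t' / D\<^sup>2 * (s * Y * (t' - r') / D\<^sup>2) / (Y / D)\<^sup>2 = s * (X * (t' * (t' - r'))) / D\<^sup>2"
    using p by (simp_all add: power2_eq_square)
  ultimately show "one_sq l * diag_sq l / (\<phi> l)\<^sup>2 = two_sq l * diag_sq (l + 1) / (\<phi> (l + 1))\<^sup>2"
    unfolding d[symmetric] h by simp
qed

end

section \<open>The two solutions satisfy the cell equations\<close>

text \<open>The diagonal values enter as a parameter, which the case distinctions of the two parts of the theorem instantiate.\<close>

locale standard_cells = even_Dstar +
  fixes d :: "nat \<Rightarrow> real"
  assumes d: "1 \<le> l \<Longrightarrow> l < N div 2 \<Longrightarrow> d l = diag_cell N s l"
begin

abbreviation val where "val \<equiv> val_ijk N s d"

lemma val_nonzero: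
  assumes "triangle N p q r"
  shows "val p q r \<noteq> 0"
  using assms
proof (cases rule: triangle_cases)
  case (diag l)
  then show ?thesis using diag_cell_pos[of l] by (auto simp: val_ijk_values d)
next
  case (step l)
  then show ?thesis using val_one_up_pos[of l] val_two_up_pos[of l]
    by (auto simp: val_ijk_values[unfolded Suc_eq_plus1[symmetric]])
qed

lemma val_diag_up:
  assumes "1 \<le> l" "l < N div 2"
  shows "(val l l (l + 1))\<^sup>2 = one_sq l" "l + 1 = N div 2 \<Longrightarrow> val l l (l + 1) = 0"
proof -
  show "(val l l (l + 1))\<^sup>2 = one_sq l"
    unfolding val_ijk_values by (rule val_one_up_square[OF assms])
  assume "l + 1 = N div 2"
  then have "2 * l + 2 = N" using even by auto
  then have "qint N (2 * l + 2) = 0" using qint_N[OF N4] by simp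
  then show "val l l (l + 1) = 0"
    unfolding val_ijk_values val_one_up_def by simp
qed

lemma val_diag_down:
  assumes "1 \<le> l" "l < N div 2"
  shows "(val l l (l - 1))\<^sup>2 = two_sq (l - 1)" "l = 1 \<Longrightarrow> val l l 0 = 0"
proof -
  obtain k where k: "l = k + 1" using assms(1) by (metis add.commute le_Suc_ex plus_1_eq_Suc)
  show "(val l l (l - 1))\<^sup>2 = two_sq (l - 1)"
    using val_two_up_square[of k] assms k by (simp add: val_ijk_values[unfolded Suc_eq_plus1[symmetric]])
  show "l = 1 \<Longrightarrow> val l l 0 = 0"
    using val_ijk_values(7)[of N s d 0] by (simp add: val_two_up_def)
qed

lemma val_diag:
  assumes "1 \<le> l" "l < N div 2"
  shows "(val l l l)\<^sup>2 = diag_sq l"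
  unfolding val_ijk_values d[OF assms] by (rule diag_cell_square[OF assms])

lemma val_level_I_diag:
  assumes "1 \<le> l" "l < N div 2"
  shows "(\<Sum>r\<in>apexes N l l. (val l l r)\<^sup>2) = qint N 2 * \<phi> l * \<phi> l"
proof -
  have "(\<Sum>r\<in>apexes N l l. (val l l r)\<^sup>2) = (val l l (l - 1))\<^sup>2 + (val l l l)\<^sup>2 + (val l l (l + 1))\<^sup>2"
    by (rule sum_apexes_diag[OF assms]) (use val_diag_up(2) val_diag_down(2) assms in auto)
  then show ?thesis
    using sq_type_I_diag[OF assms] val_diag_up(1) val_diag_down(1) val_diag assms by simp
qed

lemma val_level_I_step:
  assumes "1 \<le> l" "l + 1 < N div 2"
  shows "(\<Sum>r\<in>apexes N l (l + 1). (val l (l + 1) r)\<^sup>2) = qint N 2 * \<phi> l * \<phi> (l + 1)"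
  unfolding apexes_edge[OF assms] using sq_type_I_step[OF assms] assms
  by (simp add: val_ijk_values[unfolded Suc_eq_plus1[symmetric]] val_one_up_square val_two_up_square)

lemma val_level_I: "level_I N (\<lambda>p q r. of_real (val p q r))"
  unfolding level_I_def
proof (intro ballI impI)
  fix p q assume pq: "p \<in> levels N" "q \<in> levels N" "near p q"
  have "(\<Sum>r\<in>apexes N p q. (val p q r)\<^sup>2) = qint N 2 * \<phi> p * \<phi> q"
  proof -
    consider "p = q" | "q = p + 1" | "p = q + 1" using pq by (force simp: near_def)
    then show ?thesis
    proof cases
      case 1
      then show ?thesis using val_level_I_diag pq by (simp add: levels_def)
    next
      case 2
      then show ?thesis using val_level_I_step[of p] pq by (simp add: levels_def)
    next
      case 3
      then show ?thesis using val_level_I_step[of q] pq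
        unfolding apexes_commute[of N p] val_ijk_swap[of _ _ _ p]
        by (simp add: levels_def mult_ac)
    qed
  qed
  then show "(\<Sum>r\<in>apexes N p q. (cmod (of_real (val p q r)))\<^sup>2) = qint N 2 * \<phi> p * \<phi> q"
    by simp
qed

text \<open>The two sides of the type II equation on a square; the values are real, so no conjugates occur.\<close>

definition square_sum where
  "square_sum p q p' q' = (\<Sum>r\<in>apexes N p q \<inter> apexes N p' q'.
     inverse (\<phi> r) * (val p q r * val p' q r * val p' q' r * val p q' r))"

definition square_val where
  "square_val p q p' q' = of_bool (q = q') * (\<phi> p * \<phi> q * \<phi> p') + of_bool (p = p') * (\<phi> p * \<phi> q * \<phi> q')"

text \<open>Three reflections of a square, which reduce the type II equations to six shapes.\<close>

lemma square_symmetries: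
  "square_sum p q p' q' = square_sum p q' p' q" "square_val p q p' q' = square_val p q' p' q"
  "square_sum p q p' q' = square_sum p' q p q'" "square_val p q p' q' = square_val p' q p q'"
  "square_sum p q p' q' = square_sum q p q' p'" "square_val p q p' q' = square_val q p q' p'"
proof -
  show "square_sum p q p' q' = square_sum p q' p' q" "square_sum p q p' q' = square_sum p' q p q'"
    unfolding square_sum_def by (rule sum.cong; auto simp: apexes_def)+
  show "square_sum p q p' q' = square_sum q p q' p'"
    unfolding square_sum_def apexes_commute[of N q] apexes_commute[of N q']
    using val_ijk_swap[of N s d q] val_ijk_swap[of N s d q'] by (simp add: mult_ac)
qed (auto simp: square_val_def mult_ac)

lemma square_degenerate:
  "square_sum p q p q' = (\<Sum>r\<in>apexes N p q \<inter> apexes N p q'. inverse (\<phi> r) * ((val p q r)\<^sup>2 * (val p q' r)\<^sup>2))"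
  unfolding square_sum_def by (simp add: power2_eq_square mult_ac)

lemma square_diag:
  assumes "1 \<le> l" "l < N div 2"
  shows "square_sum l l l l = square_val l l l l"
proof -
  have "square_sum l l l l = inverse (\<phi> (l - 1)) * ((val l l (l - 1))\<^sup>2 * (val l l (l - 1))\<^sup>2)
     + inverse (\<phi> l) * ((val l l l)\<^sup>2 * (val l l l)\<^sup>2)
     + inverse (\<phi> (l + 1)) * ((val l l (l + 1))\<^sup>2 * (val l l (l + 1))\<^sup>2)"
    unfolding square_degenerate Int_absorb
    by (rule sum_apexes_diag[OF assms]) (use val_diag_up(2) val_diag_down(2) assms in auto)
  also have "\<dots> = 2 * (\<phi> l) ^ 3"
    unfolding val_diag_up(1)[OF assms] val_diag_down(1)[OF assms] val_diag[OF assms]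
      power2_eq_square[symmetric] by (rule sq_type_II_diag[OF assms])
  also have "\<dots> = square_val l l l l"
    by (simp add: square_val_def eval_nat_numeral)
  finally show ?thesis .
qed

text \<open>In the last, nondegenerate square the two terms of the sum contain one diagonal value each, at levels
  \<open>l\<close> and \<open>l + 1\<close>. They have equal modulus, and cancel because of the alternating sign of the
  diagonal values.\<close>

lemma square_step:
  assumes l: "1 \<le> l" "l + 1 < N div 2"
  shows "square_sum l (l + 1) l (l + 1) = square_val l (l + 1) l (l + 1)"
    "square_sum l l l (l + 1) = square_val l l l (l + 1)"
    "square_sum (l + 1) l (l + 1) (l + 1) = square_val (l + 1) l (l + 1) (l + 1)"
    "square_sum l l (l + 1) (l + 1) = square_val l l (l + 1) (l + 1)"
proof -
  have l': "l < N div 2" "1 \<le> l + 1" using l by auto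
  have v: "(val_one_up N s l)\<^sup>2 = one_sq l" "(val_two_up N s l)\<^sup>2 = two_sq l"
    "(d l)\<^sup>2 = diag_sq l" "(d (l + 1))\<^sup>2 = diag_sq (l + 1)"
    using val_one_up_square[OF l(1) l'(1)] val_two_up_square[OF l(2)]
      diag_cell_square[OF l(1) l'(1)] diag_cell_square[OF l'(2) l(2)] d[OF l(1) l'(1)] d[OF l'(2) l(2)]
    by auto
  have sum2: "(\<Sum>r\<in>{l, l + 1}. F r) = F l + F (l + 1)" for F :: "nat \<Rightarrow> real" by simp
  show "square_sum l (l + 1) l (l + 1) = square_val l (l + 1) l (l + 1)"
    unfolding square_degenerate Int_absorb apexes_edge[OF l] sum2 val_ijk_values v
      power2_eq_square[symmetric] sq_type_II_step(1)[OF l]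
    by (simp only: square_val_def of_bool_eq mult_1_left HOL.refl if_True distrib_left mult.assoc)
  show "square_sum l l l (l + 1) = square_val l l l (l + 1)"
    unfolding square_degenerate apexes_edge(3,4)[OF l] sum2 val_ijk_values v sq_type_II_step(2)[OF l]
    by (simp add: square_val_def power2_eq_square)
  have "one_sq l * two_sq l = two_sq l * one_sq l" by simp
  then show "square_sum (l + 1) l (l + 1) (l + 1) = square_val (l + 1) l (l + 1) (l + 1)"
    using sq_type_II_step(3)[OF l]
    unfolding square_degenerate apexes_edge(3,4)[OF l] sum2 val_ijk_values v
    by (simp add: square_val_def power2_eq_square mult_ac)
  define a a' where "a = (-1) ^ (l + 1) * d l" "a' = (-1) ^ (l + 1 + 1) * d (l + 1)"
  have sgn: "(-1) ^ (l + 1) * (-1) ^ (l + 1) = (1 :: real)" by (simp add: power_add[symmetric])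
  have pos: "a > 0" "a' > 0" "val_one_up N s l > 0" "val_two_up N s l > 0" "\<phi> l > 0" "\<phi> (l + 1) > 0"
    using diag_cell_pos[OF l(1) l'(1)] diag_cell_pos[OF l'(2) l(2)] d[OF l(1) l'(1)] d[OF l'(2) l(2)]
      val_one_up_pos[OF l] val_two_up_pos[OF l] phi_pos[OF l(1) l'(1)] phi_pos[OF l'(2) l(2)]
    by (auto simp: a_a'_def)
  have "a\<^sup>2 = diag_sq l" "a'\<^sup>2 = diag_sq (l + 1)"
    unfolding a_a'_def v[symmetric] by (auto simp: power_mult_distrib power_mult[symmetric])
  note a_sq = this
  have w: "(x * y / z)\<^sup>2 = x\<^sup>2 * y\<^sup>2 / z\<^sup>2" for x y z :: real
    by (simp add: power_divide power_mult_distrib)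
  have "(val_one_up N s l * a / \<phi> l)\<^sup>2 = (val_two_up N s l * a' / \<phi> (l + 1))\<^sup>2"
    unfolding w v a_sq by (rule sq_type_II_step(4)[OF l])
  then have eq: "val_one_up N s l * a / \<phi> l = val_two_up N s l * a' / \<phi> (l + 1)"
    by (rule power2_eq_imp_eq) (intro divide_nonneg_nonneg mult_nonneg_nonneg less_imp_le pos)+
  have dd: "d l = (-1) ^ (l + 1) * a" "d (l + 1) = - ((-1) ^ (l + 1)) * a'"
    unfolding a_a'_def using sgn by (auto simp: mult.assoc[symmetric])
  have "square_sum l l (l + 1) (l + 1) = (-1) ^ (l + 1) * (val_one_up N s l * val_two_up N s l) *
     (val_one_up N s l * a / \<phi> l - val_two_up N s l * a' / \<phi> (l + 1))"
    unfolding square_sum_def apexes_edge(5)[OF l] sum2 val_ijk_values dd divide_inverse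
    by (simp only: algebra_simps)
  then show "square_sum l l (l + 1) (l + 1) = square_val l l (l + 1) (l + 1)"
    unfolding eq by (simp add: square_val_def)
qed

lemma square_gap:
  assumes l: "1 \<le> l" "l + 2 < N div 2"
  shows "square_sum (l + 1) l (l + 1) (l + 2) = square_val (l + 1) l (l + 1) (l + 2)"
proof -
  have b: "1 \<le> l + 1" "l + 1 < N div 2" using l by auto
  have n: "l + 2 = l + 1 + 1" by simp
  have "square_sum (l + 1) l (l + 1) (l + 2) = inverse (\<phi> (l + 1)) * (two_sq l * one_sq (l + 1))"
    unfolding square_degenerate apexes_gap[OF l] unfolding n using val_ijk_values(6)[of N s d l]
      val_ijk_values(3)[of N s d "l + 1"] val_one_up_square[OF b] val_two_up_square[OF b(2)] by simp
  also have "\<dots> = inverse (\<phi> (l + 1)) * ((\<phi> (l + 1))\<^sup>2 * \<phi> l * \<phi> (l + 2))"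
    using sq_type_II_gap[OF b] by simp
  also have "\<dots> = square_val (l + 1) l (l + 1) (l + 2)"
    using phi_pos[OF b] unfolding square_val_def power2_eq_square by (simp add: mult.assoc[symmetric])
  finally show ?thesis .
qed

text \<open>Up to reflection a square is degenerate, with \<open>p = p'\<close> and \<open>q \<le> q'\<close>, or it is the square with
  levels \<open>l\<close>, \<open>l\<close>, \<open>l + 1\<close>, \<open>l + 1\<close>.\<close>

lemma square_equation:
  assumes "p \<in> levels N" "q \<in> levels N" "p' \<in> levels N" "q' \<in> levels N"
    and "near p q" "near p' q" "near p' q'" "near p q'"
  shows "square_sum p q p' q' = square_val p q p' q'"
proof -
  have ordered: "square_sum p q p q' = square_val p q p q'"
    if l: "p \<in> levels N" "q \<in> levels N" "q' \<in> levels N" and n: "near p q" "near p q'" and "q \<le> q'" for p q q'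
  proof -
    have "(q = p \<and> q' = p) \<or> (q = p + 1 \<and> q' = p + 1) \<or> (p = q + 1 \<and> q' = q) \<or> (q = p \<and> q' = p + 1)
        \<or> (p = q + 1 \<and> q' = q + 1) \<or> (p = q + 1 \<and> q' = q + 2)"
      using n \<open>q \<le> q'\<close> by (auto simp: near_def)
    then consider "q = p" "q' = p" | "q = p + 1" "q' = p + 1" | "p = q + 1" "q' = q" | "q = p" "q' = p + 1"
        | "p = q + 1" "q' = q + 1" | "p = q + 1" "q' = q + 2" by blast
    then show ?thesis
    proof cases
      case 1
      then show ?thesis using square_diag l by (simp add: levels_def)
    next
      case 2
      then show ?thesis using square_step(1) l by (simp add: levels_def)
    next
      case 3
      have "square_sum (q + 1) q (q + 1) q = square_val (q + 1) q (q + 1) q"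
        unfolding square_symmetries(5,6)[of "q + 1"] using l 3 by (intro square_step(1)) (auto simp: levels_def)
      then show ?thesis using 3 by simp
    next
      case 4
      then show ?thesis using square_step(2) l by (simp add: levels_def)
    next
      case 5
      then show ?thesis using square_step(3) l by (simp add: levels_def)
    next
      case 6
      then show ?thesis using square_gap l by (simp add: levels_def)
    qed
  qed
  have degenerate: "square_sum p q p q' = square_val p q p q'"
    if "p \<in> levels N" "q \<in> levels N" "q' \<in> levels N" "near p q" "near p q'" for p q q'
    using ordered that square_symmetries(1,2)[of p q p q'] by (metis nat_le_linear)
  have proper: "square_sum p q p' q' = square_val p q p' q'"
    if l: "p \<in> levels N" "q \<in> levels N" "p' \<in> levels N" "q' \<in> levels N"
      and n: "near p q" "near p' q" "near p' q'" "near p q'" and lt: "p < p'" "q < q'" for p q p' q'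
  proof -
    have "q = p" "p' = p + 1" "q' = p + 1" using n lt by (auto simp: near_def)
    then show ?thesis using square_step(4)[of p] l by (simp add: levels_def)
  qed
  consider "p = p'" | "q = q'" | "p < p'" "q < q'" | "p < p'" "q' < q" | "p' < p" "q < q'" | "p' < p" "q' < q"
    by linarith
  then show ?thesis
  proof cases
    case 1
    then show ?thesis using degenerate assms by blast
  next
    case 2
    then show ?thesis using degenerate[of q p p'] assms square_symmetries(5,6)[of p q p' q']
      by (metis near_commute)
  next
    case 3
    then show ?thesis using proper assms by blast
  next
    case 4
    then show ?thesis using proper[of p q' p' q] assms square_symmetries(1,2)[of p q p' q'] by metis
  next
    case 5
    then show ?thesis using proper[of p' q p q'] assms square_symmetries(3,4)[of p q p' q'] by metis
  next
    case 6
    then show ?thesis using proper[of p' q' p q] assms square_symmetries(1,2)[of p q p' q']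
        square_symmetries(3,4)[of p q' p' q] by metis
  qed
qed

lemma val_level_II: "level_II N (\<lambda>p q r. of_real (val p q r))"
  unfolding level_II_def
proof (intro ballI impI, elim conjE)
  fix p q p' q' assume l: "p \<in> levels N" "q \<in> levels N" "p' \<in> levels N" "q' \<in> levels N"
    and n: "near p q" "near p' q" "near p' q'" "near p q'"
  show "(\<Sum>r\<in>apexes N p q \<inter> apexes N p' q'. of_real (inverse (\<phi> r))
        * of_real (val p q r) * cnj (of_real (val p' q r)) * of_real (val p' q' r) * cnj (of_real (val p q' r)))
     = of_bool (q = q') * (of_real (\<phi> p * \<phi> q * \<phi> p') :: complex)
       + of_bool (p = p') * of_real (\<phi> p * \<phi> q * \<phi> q')"
    (is "?S = ?V")
  proof -
    have "?S = of_real (square_sum p q p' q')"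
      unfolding square_sum_def of_real_sum of_real_mult complex_cnj_complex_of_real by (simp only: mult.assoc)
    also have "\<dots> = of_real (square_val p q p' q')"
      unfolding square_equation[OF l n] ..
    also have "\<dots> = ?V"
      by (cases "q = q'"; cases "p = p'") (simp_all add: square_val_def)
    finally show ?thesis .
  qed
qed

definition cells :: "(vertex \<times> vertex) cells" where
  "cells \<alpha> \<beta> \<gamma> = of_real (rotated val (fst \<alpha>) (fst \<beta>) (fst \<gamma>))"

lemma cell_at_cells: "cyclic_types A B C \<Longrightarrow> cell_at cells (A p) (B q) (C r) = of_real (val p q r)"
  unfolding cyclic_types_def cells_def cell_at_def
  using val_ijk_rotate[of N s d r p q] val_ijk_rotate[of N s d p q r] by auto

lemma rotated_rotate: "rotated f a b c = rotated f b c a"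
  by (cases a; cases b; cases c) simp_all

lemma cells_Z3_symmetric: "Z3_symmetric_solution N cells"
  unfolding Z3_symmetric_solution_def cell_system_def type_I_levels type_II_levels
proof (intro conjI allI impI)
  show "rotation_invariant (Dstar N) cells"
    unfolding rotation_invariant_def cells_def by (simp add: rotated_rotate[symmetric])
next
  fix A B C assume t: "cyclic_types A B C"
  show "level_I N (\<lambda>p q r. cell_at cells (A p) (B q) (C r))"
    "level_II N (\<lambda>p q r. cell_at cells (A p) (B q) (C r))"
    unfolding cell_at_cells[OF t] by (rule val_level_I val_level_II)+
next
  have t: "cyclic_types vi vj vk" by (simp add: cyclic_types_def)
  fix p q r
  show "cmod (cell_at cells (vi p) (vj q) (vk r)) = cmod (cell_at cells (vi q) (vj r) (vk p))"
    "cmod (cell_at cells (vi q) (vj r) (vk p)) = cmod (cell_at cells (vi r) (vj p) (vk q))"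
    unfolding cell_at_cells[OF t] by (metis val_ijk_rotate)+
qed

end

section \<open>The equations determine the moduli\<close>

definition moduli_rotate where
  "moduli_rotate N f \<longleftrightarrow> (\<forall>p q r. triangle N p q r \<longrightarrow> cmod (f p q r) = cmod (f q r p))"

lemma moduli_rotate_values:
  assumes "moduli_rotate N f" "1 \<le> l" "l + 1 < N div 2"
  shows "cmod (f l (l + 1) l) = cmod (f l l (l + 1))" "cmod (f (l + 1) l l) = cmod (f l l (l + 1))"
    "cmod (f (l + 1) l (l + 1)) = cmod (f l (l + 1) (l + 1))"
    "cmod (f (l + 1) (l + 1) l) = cmod (f l (l + 1) (l + 1))"
proof -
  have t: "triangle N l l (l + 1)" "triangle N l (l + 1) l"
    "triangle N (l + 1) (l + 1) l" "triangle N (l + 1) l (l + 1)"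
    using assms(2,3) by (auto simp: triangle_def levels_def near_def)
  show "cmod (f l (l + 1) l) = cmod (f l l (l + 1))" "cmod (f (l + 1) l l) = cmod (f l l (l + 1))"
    "cmod (f (l + 1) l (l + 1)) = cmod (f l (l + 1) (l + 1))"
    "cmod (f (l + 1) (l + 1) l) = cmod (f l (l + 1) (l + 1))"
    using t assms(1) unfolding moduli_rotate_def by metis+
qed

text \<open>The part of a $\mathbb{Z}_3$-symmetric solution that the classification uses: the equations for edges from \<open>i\<close> to \<open>j\<close>.\<close>

locale level_solution =
  fixes N :: nat and f :: "nat \<Rightarrow> nat \<Rightarrow> nat \<Rightarrow> complex"
  assumes I: "level_I N f" and II: "level_II N f" and rot: "moduli_rotate N f"
begin

lemma norm_type_I_step:
  assumes l: "1 \<le> l" "l + 1 < N div 2"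
  shows "(cmod (f l l (l + 1)))\<^sup>2 + (cmod (f l (l + 1) (l + 1)))\<^sup>2
     = qint N 2 * level_phi N l * level_phi N (l + 1)"
proof -
  have "(\<Sum>r\<in>apexes N l (l + 1). (cmod (f l (l + 1) r))\<^sup>2) = qint N 2 * level_phi N l * level_phi N (l + 1)"
    using I l unfolding level_I_def by (simp add: levels_def near_def)
  then show ?thesis unfolding apexes_edge[OF l] using moduli_rotate_values(1)[OF rot l] by simp
qed

lemma norm_type_I_diag:
  assumes l: "1 \<le> l" "l < N div 2"
  shows "(cmod (f l l l))\<^sup>2 = qint N 2 * level_phi N l * level_phi N l -
     (\<Sum>r\<in>apexes N l l - {l}. (cmod (f l l r))\<^sup>2)"
proof -
  have "(\<Sum>r\<in>apexes N l l. (cmod (f l l r))\<^sup>2) = qint N 2 * level_phi N l * level_phi N l"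
    using I l unfolding level_I_def by (simp add: levels_def near_def)
  moreover have "l \<in> apexes N l l" using l by (auto simp: apexes_def levels_def near_def)
  ultimately show ?thesis by (subst (asm) sum.remove[of _ l]) auto
qed

text \<open>On a degenerate square the products of cells with conjugates are squared moduli, so phases drop out.\<close>

lemma norm_type_II_degenerate:
  assumes "p \<in> levels N" "q \<in> levels N" "q' \<in> levels N" "near p q" "near p q'"
  shows "(\<Sum>r\<in>apexes N p q \<inter> apexes N p q'.
        inverse (level_phi N r) * ((cmod (f p q r))\<^sup>2 * (cmod (f p q' r))\<^sup>2))
     = of_bool (q = q') * (level_phi N p * level_phi N q * level_phi N p)
       + level_phi N p * level_phi N q * level_phi N q'"
proof -
  have e: "of_real c * a * cnj a * b * cnj b = of_real (c * ((cmod a)\<^sup>2 * (cmod b)\<^sup>2))" for c a b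
    unfolding of_real_mult complex_norm_square by simp
  have "of_real (\<Sum>r\<in>apexes N p q \<inter> apexes N p q'.
        inverse (level_phi N r) * ((cmod (f p q r))\<^sup>2 * (cmod (f p q' r))\<^sup>2))
     = (\<Sum>r\<in>apexes N p q \<inter> apexes N p q'. of_real (inverse (level_phi N r))
        * f p q r * cnj (f p q r) * f p q' r * cnj (f p q' r))"
    unfolding of_real_sum e ..
  also have "\<dots> = of_real (of_bool (q = q') * (level_phi N p * level_phi N q * level_phi N p)
       + level_phi N p * level_phi N q * level_phi N q')"
    using II[unfolded level_II_def, THEN bspec, OF assms(1), THEN bspec, OF assms(2),
        THEN bspec, OF assms(1), THEN bspec, OF assms(3)] assms(4,5)
    by simp
  finally show ?thesis unfolding of_real_eq_iff .
qed

lemma norm_type_II_gap: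
  assumes l: "1 \<le> l" "l + 2 < N div 2"
  shows "inverse (level_phi N (l + 1)) *
      ((cmod (f l (l + 1) (l + 1)))\<^sup>2 * (cmod (f (l + 1) (l + 1) (l + 2)))\<^sup>2)
     = level_phi N (l + 1) * level_phi N l * level_phi N (l + 2)"
proof -
  have 1: "cmod (f (l + 1) l (l + 1)) = cmod (f l (l + 1) (l + 1))"
    using moduli_rotate_values[OF rot, of l] l by simp
  have 2: "cmod (f (l + 1) (l + 2) (l + 1)) = cmod (f (l + 1) (l + 1) (l + 2))"
    using moduli_rotate_values(1)[OF rot, of "l + 1"] l by simp
  show ?thesis
    using norm_type_II_degenerate[of "l + 1" l "l + 2"] l unfolding apexes_gap[OF l]
    by (simp add: 1[simplified] 2[simplified] levels_def near_def)
qed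

lemma norm_type_II_step:
  assumes l: "1 \<le> l" "l + 1 < N div 2"
  shows "inverse (level_phi N l) * ((cmod (f l l (l + 1)))\<^sup>2)\<^sup>2
     + inverse (level_phi N (l + 1)) * ((cmod (f l (l + 1) (l + 1)))\<^sup>2)\<^sup>2
     = level_phi N l * level_phi N (l + 1) * (level_phi N l + level_phi N (l + 1))"
  using norm_type_II_degenerate[of l "l + 1" "l + 1"] l moduli_rotate_values(1)[OF rot l]
  unfolding Int_absorb apexes_edge[OF l]
  by (simp add: levels_def near_def power2_eq_square[symmetric] distrib_left)

text \<open>The only kind of equation in which phases enter.\<close>

lemma square_phase:
  assumes l: "1 \<le> l" "l + 1 < N div 2"
  shows "of_real (inverse (level_phi N l))
      * (f l l l * cnj (f (l + 1) l l) * f (l + 1) (l + 1) l * cnj (f l (l + 1) l))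
    + of_real (inverse (level_phi N (l + 1))) * (f l l (l + 1) * cnj (f (l + 1) l (l + 1))
       * f (l + 1) (l + 1) (l + 1) * cnj (f l (l + 1) (l + 1))) = 0"
proof -
  have a: "l \<in> levels N" "l + 1 \<in> levels N" using l by (auto simp: levels_def)
  have "near l l \<and> near (l + 1) l \<and> near (l + 1) (l + 1) \<and> near l (l + 1)" by (auto simp: near_def)
  with II[unfolded level_II_def, THEN bspec, OF a(1), THEN bspec, OF a(1),
        THEN bspec, OF a(2), THEN bspec, OF a(2)]
  show ?thesis unfolding apexes_edge[OF l] by (simp add: mult.assoc)
qed

end

text \<open>The modulus on $(1,1,2)$ propagates upwards: $b_l$ gives $c_l$ by type I, and $c_l$ gives $b_{l+1}$ by the
  type II equation for $c_l b_{l+1}$, where $c_l \neq 0$ since \<open>g\<close> does not vanish. Finally type I gives $a_l$.\<close>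

lemma moduli_determined:
  assumes f: "level_solution N f" and g: "level_solution N g"
    and nz: "\<And>p q r. triangle N p q r \<Longrightarrow> g p q r \<noteq> 0"
    and phi: "\<And>l. 1 \<le> l \<Longrightarrow> l < N div 2 \<Longrightarrow> level_phi N l > 0"
    and start: "2 < N div 2 \<Longrightarrow> cmod (f 1 1 2) = cmod (g 1 1 2)"
    and t: "triangle N p q r"
  shows "cmod (f p q r) = cmod (g p q r)"
proof -
  interpret f: level_solution N f by fact
  interpret g: level_solution N g by fact
  have two: "(cmod (f l (l + 1) (l + 1)))\<^sup>2 = (cmod (g l (l + 1) (l + 1)))\<^sup>2"
    if "1 \<le> l" "l + 1 < N div 2" "cmod (f l l (l + 1)) = cmod (g l l (l + 1))" for l
    using f.norm_type_I_step[OF that(1,2)] g.norm_type_I_step[OF that(1,2)] unfolding that(3) by linarith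
  have one: "cmod (f l l (l + 1)) = cmod (g l l (l + 1))" if "1 \<le> l" "l + 1 < N div 2" for l
    using that
  proof (induction l rule: nat_induct_at_least)
    case base
    then show ?case using start by (simp add: numeral_2_eq_2)
  next
    case (Suc l)
    then have l: "1 \<le> l" "l + 2 < N div 2" "l + 1 < N div 2" by auto
    have "g l (l + 1) (l + 1) \<noteq> 0" by (rule nz) (use l in \<open>auto simp: triangle_def levels_def near_def\<close>)
    moreover have "level_phi N (l + 1) \<noteq> 0"
      by (rule less_imp_neq[OF phi, symmetric]) (use l in auto)
    moreover have "(cmod (f l (l + 1) (l + 1)))\<^sup>2 = (cmod (g l (l + 1) (l + 1)))\<^sup>2"
      using two[OF l(1,3) Suc.IH] l by simp
    ultimately have "(cmod (f (l + 1) (l + 1) (l + 2)))\<^sup>2 = (cmod (g (l + 1) (l + 1) (l + 2)))\<^sup>2"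
      using trans[OF f.norm_type_II_gap[OF l(1,2)] g.norm_type_II_gap[OF l(1,2), symmetric]]
      by (simp only: mult_cancel_left inverse_nonzero_iff_nonzero power_eq_0_iff norm_eq_zero) simp
    then show ?case by simp
  qed
  have two: "cmod (f l (l + 1) (l + 1)) = cmod (g l (l + 1) (l + 1))" if "1 \<le> l" "l + 1 < N div 2" for l
    using two[OF that one[OF that]] by simp
  note fr = moduli_rotate_values[OF f.rot] and gr = moduli_rotate_values[OF g.rot]
  have diag: "cmod (f l l l) = cmod (g l l l)" if l: "1 \<le> l" "l < N div 2" for l
  proof -
    have "cmod (f l l r) = cmod (g l l r)" if "r \<in> apexes N l l - {l}" for r
    proof -
      consider "r = l + 1" "l + 1 < N div 2" | "l = r + 1" "1 \<le> r"
        using \<open>r \<in> apexes N l l - {l}\<close> unfolding apexes_def levels_def near_def by fastforce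
      then show ?thesis
      proof cases
        case 1
        then show ?thesis using one l by simp
      next
        case 2
        then show ?thesis using two[of r] fr(4)[of r] gr(4)[of r] l by simp
      qed
    qed
    then have "(cmod (f l l l))\<^sup>2 = (cmod (g l l l))\<^sup>2"
      unfolding f.norm_type_I_diag[OF l] g.norm_type_I_diag[OF l] by simp
    then show ?thesis by simp
  qed
  show ?thesis using t
  proof (cases rule: triangle_cases)
    case (diag l)
    then show ?thesis using \<open>\<And>l. 1 \<le> l \<Longrightarrow> l < N div 2 \<Longrightarrow> cmod (f l l l) = cmod (g l l l)\<close> by simp
  next
    case (step l)
    then show ?thesis using one[OF step(1,2)] two[OF step(1,2)] fr[OF step(1,2)] gr[OF step(1,2)] by auto
  qed
qed

text \<open>All three solutions satisfy the same quadratic equation for the squared modulus on $(1,1,2)$. It has only two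
  roots, and \<open>g\<close> and \<open>h\<close> provide two different ones.\<close>

lemma start_determined:
  assumes f: "level_solution N f" and g: "level_solution N g" and h: "level_solution N h"
    and phi: "level_phi N 1 > 0" "level_phi N 2 > 0" and N: "2 < N div 2"
    and ne: "cmod (g 1 1 2) \<noteq> cmod (h 1 1 2)"
  shows "cmod (f 1 1 2) = cmod (g 1 1 2) \<or> cmod (f 1 1 2) = cmod (h 1 1 2)"
proof -
  define S where "S = qint N 2 * level_phi N 1 * level_phi N 2"
  define R where "R = level_phi N 1 * level_phi N 2 * (level_phi N 1 + level_phi N 2)"
  define a b where "a = inverse (level_phi N 1)" "b = inverse (level_phi N 2)"
  have quad: "a * ((cmod (k 1 1 2))\<^sup>2)\<^sup>2 + b * (S - (cmod (k 1 1 2))\<^sup>2)\<^sup>2 = R" if "level_solution N k" for k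
  proof -
    interpret level_solution N k by fact
    have "1 + 1 < N div 2" using N by simp
    then have 1: "(cmod (k 1 1 2))\<^sup>2 + (cmod (k 1 2 2))\<^sup>2 = S"
      "a * ((cmod (k 1 1 2))\<^sup>2)\<^sup>2 + b * ((cmod (k 1 2 2))\<^sup>2)\<^sup>2 = R"
      using norm_type_I_step[of 1] norm_type_II_step[of 1] unfolding S_def R_def a_b_def one_add_one
      by auto
    then have "(cmod (k 1 2 2))\<^sup>2 = S - (cmod (k 1 1 2))\<^sup>2" by simp
    then show ?thesis using 1(2) by simp
  qed
  define x y z where "x = (cmod (f 1 1 2))\<^sup>2" "y = (cmod (g 1 1 2))\<^sup>2" "z = (cmod (h 1 1 2))\<^sup>2"
  note Q = quad[OF f, folded x_y_z_def] quad[OF g, folded x_y_z_def] quad[OF h, folded x_y_z_def]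
  have "(x - y) * ((a + b) * (x + y) - 2 * b * S) =
      (a * x\<^sup>2 + b * (S - x)\<^sup>2) - (a * y\<^sup>2 + b * (S - y)\<^sup>2)"
    by (simp add: algebra_simps power2_eq_square)
  moreover have "(x - z) * ((a + b) * (x + z) - 2 * b * S) =
      (a * x\<^sup>2 + b * (S - x)\<^sup>2) - (a * z\<^sup>2 + b * (S - z)\<^sup>2)"
    by (simp add: algebra_simps power2_eq_square)
  ultimately have 1: "x = y \<or> (a + b) * (x + y) = 2 * b * S" "x = z \<or> (a + b) * (x + z) = 2 * b * S"
    unfolding Q by auto
  have "y \<noteq> z" using ne by (simp add: x_y_z_def)
  moreover have "a + b > 0" unfolding a_b_def by (intro add_pos_pos positive_imp_inverse_positive phi)
  ultimately have "(a + b) * (x + y) \<noteq> (a + b) * (x + z)" by simp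
  then have "x = y \<or> x = z" using 1 by metis
  then show ?thesis by (simp add: x_y_z_def)
qed

section \<open>Phases\<close>

text \<open>Let $h_{abc}$ be the values of \<open>h\<close> on the cube with corners \<open>l\<close> (index 0) and \<open>l + 1\<close> (index 1). Normalise
  the diagonal edges by $x_{00} = h_{000}$ and $x_{11} = h_{111}$, with the diagonal values of \<open>y\<close> and \<open>z\<close> equal to 1;
  this depends only on the corners shared with the neighbouring cubes. The six remaining
  corners give equations for products of two consecutive terms of the cycle
  $z_{10}, y_{01}, x_{10}, z_{01}, y_{10}, x_{01}$. Starting from $z_{10} = 1$, five of them are solved in turn,
  and the sixth is the flatness condition.\<close>

lemma gauge:
  fixes h :: "nat \<Rightarrow> nat \<Rightarrow> nat \<Rightarrow> complex"
  assumes unit: "\<And>p q r. cmod (h p q r) = 1"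
    and flat: "\<And>l. 1 \<le> l \<Longrightarrow> l + 1 < N div 2 \<Longrightarrow>
       h l l l * cnj (h (l + 1) l l) * h (l + 1) (l + 1) l * cnj (h l (l + 1) l) =
       h l l (l + 1) * cnj (h (l + 1) l (l + 1)) * h (l + 1) (l + 1) (l + 1) * cnj (h l (l + 1) (l + 1))"
  obtains x y z where "\<And>p q. cmod (x p q) = 1" "\<And>p q. cmod (y p q) = 1" "\<And>p q. cmod (z p q) = 1"
    "\<And>p q r. triangle N p q r \<Longrightarrow> h p q r = x p q * y q r * z r p"
proof -
  define x where "x p q = (if p = q then h p p p
    else if p < q then h p q p * h q q q * h q p p * h p p q / (h q q p * h q p q * h p p p)
    else h p q p * h q q q / h q q p)" for p q
  define y where "y p q = (if p = q then 1 else if p < q then h p p q / h p p p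
    else h p p q * h p q p * h q q q / (h p p p * h p q q * h q q p))" for p q
  define z where "z p q = (if p = q then 1 else if p < q then h q p p * h p p q / (h q p q * h p p p) else 1)"
    for p q
  have nz: "h p q r \<noteq> 0" for p q r using unit[of p q r] by auto
  have inv: "cnj (h p q r) = inverse (h p q r)" for p q r
    using complex_norm_square[of "h p q r"] unit[of p q r] inverse_unique[of "h p q r" "cnj (h p q r)"] by simp
  show ?thesis
  proof (rule that[of x y z])
    show "cmod (x p q) = 1" "cmod (y p q) = 1" "cmod (z p q) = 1" for p q
      unfolding x_def y_def z_def by (auto simp: norm_mult norm_divide unit)
    fix p q r assume "triangle N p q r"
    then show "h p q r = x p q * y q r * z r p"
    proof (cases rule: triangle_cases)
      case (diag l)
      then show ?thesis by (simp add: x_def y_def z_def)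
    next
      case (step l)
      have "h l (l + 1) (l + 1) * (h (l + 1) (l + 1) l * h (l + 1) l (l + 1) * h l l l) =
        h l (l + 1) l * h (l + 1) (l + 1) (l + 1) * h (l + 1) l l * h l l (l + 1)"
        using flat[OF step(1,2)] unfolding inv using nz by (simp add: field_simps)
      then have "h l (l + 1) (l + 1) =
        h l (l + 1) l * h (l + 1) (l + 1) (l + 1) * h (l + 1) l l * h l l (l + 1) /
        (h (l + 1) (l + 1) l * h (l + 1) l (l + 1) * h l l l)"
        using nz by (simp add: eq_divide_eq)
      then show ?thesis using step(3) nz by (auto simp: x_def y_def z_def)
    qed
  qed
qed

fun edge_phase :: "(nat \<Rightarrow> nat \<Rightarrow> complex) \<Rightarrow> (nat \<Rightarrow> nat \<Rightarrow> complex) \<Rightarrow> (nat \<Rightarrow> nat \<Rightarrow> complex)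
    \<Rightarrow> vertex \<times> vertex \<Rightarrow> complex" where
  "edge_phase x y z (vi p, vj q) = x p q"
| "edge_phase x y z (vj q, vk r) = y q r"
| "edge_phase x y z (vk r, vi p) = z r p"
| "edge_phase x y z _ = 1"

lemma cell_at_rotate:
  assumes "rotation_invariant (Dstar N) W" "triangle N p q r"
  shows "cell_at W (vj q) (vk r) (vi p) = cell_at W (vi p) (vj q) (vk r)"
    "cell_at W (vk r) (vi p) (vj q) = cell_at W (vi p) (vj q) (vk r)"
proof -
  have t: "cyclic_types vi vj vk" "cyclic_types vk vi vj" by (auto simp: cyclic_types_def)
  have m: "vi p \<in> verts (Dstar N)" "vj q \<in> verts (Dstar N)" "vk r \<in> verts (Dstar N)"
    "(vi p, vj q) \<in> arcs_from_to (Dstar N) (vi p) (vj q)"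
    "(vj q, vk r) \<in> arcs_from_to (Dstar N) (vj q) (vk r)"
    "(vk r, vi p) \<in> arcs_from_to (Dstar N) (vk r) (vi p)"
    using assms(2) by (auto simp: triangle_def arcs_from_to_types[OF t(1)] verts_types(1)[OF t(1)])
  show "cell_at W (vj q) (vk r) (vi p) = cell_at W (vi p) (vj q) (vk r)"
    "cell_at W (vk r) (vi p) (vj q) = cell_at W (vi p) (vj q) (vk r)"
    using assms(1) m unfolding cell_at_def rotation_invariant_def by metis+
qed

text \<open>Unitary matrices of size one are phases, so an equivalence is a choice of a phase for each edge.\<close>

lemma cell_equivalentI:
  assumes W: "rotation_invariant (Dstar N) W" and W': "rotation_invariant (Dstar N) W'"
    and unit: "\<And>p q. cmod (x p q) = 1" "\<And>p q. cmod (y p q) = 1" "\<And>p q. cmod (z p q) = 1"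
    and eq: "\<And>p q r. triangle N p q r \<Longrightarrow> cell_at W (vi p) (vj q) (vk r) =
       x p q * y q r * z r p * cell_at W' (vi p) (vj q) (vk r)"
  shows "cell_equivalent (Dstar N) W W'"
  unfolding cell_equivalent_def
proof (intro exI[of _ "\<lambda>e e'. edge_phase x y z e"] conjI ballI)
  have "cmod (edge_phase x y z e) = 1" for e
    by (cases "(x, y, z, e)" rule: edge_phase.cases) (auto simp: unit)
  then have "edge_phase x y z e * cnj (edge_phase x y z e) = 1" for e
    using complex_norm_square[of "edge_phase x y z e"] by simp
  then show "unitary_matrix_on (arcs_from_to (Dstar N) i j) (\<lambda>e e'. edge_phase x y z e)" for i j
    unfolding unitary_matrix_on_def by (auto simp: arcs_from_to_Dstar mult.commute)
next
  fix i j k \<sigma> \<rho> \<gamma>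
  let ?A = "arcs_from_to (Dstar N)"
  assume a: "\<sigma> \<in> ?A i j" "\<rho> \<in> ?A j k" "\<gamma> \<in> ?A k i"
  have t: "cyclic_types vi vj vk" by (simp add: cyclic_types_def)
  have sub: "?A v w \<subseteq> {(v, w)}" for v w by (simp add: arcs_from_to_Dstar)
  have e: "\<sigma> = (i, j)" "\<rho> = (j, k)" "\<gamma> = (k, i)" "?A i j = {(i, j)}" "?A j k = {(j, k)}" "?A k i = {(k, i)}"
    using a sub by blast+
  have "\<exists>p q r. triangle N p q r \<and> (i, j, k) \<in> {(vi p, vj q, vk r), (vj q, vk r, vi p), (vk r, vi p, vj q)}"
    using a level_in_levels
    by (cases i; cases j; cases k)
      (force simp: arcs_from_to_Dstar cyclic_types_def triangle_def split: if_splits)+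
  then obtain p q r where tri: "triangle N p q r"
    and ijk: "(i, j, k) \<in> {(vi p, vj q, vk r), (vj q, vk r, vi p), (vk r, vi p, vj q)}" by blast
  have "cell_at W i j k = edge_phase x y z (i, j) * edge_phase x y z (j, k) * edge_phase x y z (k, i)
      * cell_at W' i j k"
    using ijk eq[OF tri] by (auto simp: cell_at_rotate[OF W tri] cell_at_rotate[OF W' tri] mult_ac)
  then show "W \<sigma> \<rho> \<gamma> = (\<Sum>\<sigma>'\<in>?A i j. \<Sum>\<rho>'\<in>?A j k. \<Sum>\<gamma>'\<in>?A k i.
     edge_phase x y z \<sigma> * edge_phase x y z \<rho> * edge_phase x y z \<gamma> * W' \<sigma>' \<rho>' \<gamma>')"
    unfolding e by (simp add: cell_at_def)
qed

section \<open>Classification\<close>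

lemma Z3_symmetric_solution_levels:
  assumes "Z3_symmetric_solution N W"
  shows "level_solution N (\<lambda>p q r. cell_at W (vi p) (vj q) (vk r))"
proof
  have t: "cyclic_types vi vj vk" "cyclic_types vj vk vi" "cyclic_types vk vi vj"
    by (auto simp: cyclic_types_def)
  show "level_I N (\<lambda>p q r. cell_at W (vi p) (vj q) (vk r))"
    "level_II N (\<lambda>p q r. cell_at W (vi p) (vj q) (vk r))"
    using assms t(1) unfolding Z3_symmetric_solution_def cell_system_def type_I_levels type_II_levels
    by blast+
  show "moduli_rotate N (\<lambda>p q r. cell_at W (vi p) (vj q) (vk r))"
    unfolding moduli_rotate_def
  proof (intro allI impI)
    fix p q r assume tri: "triangle N p q r"
    have arcs: "(v, w) \<in> arcs (Dstar N)" if "(v, w) \<in> arcs_from_to (Dstar N) v w" for v w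
      using that by (simp add: arcs_from_to_def)
    have "(vi p, vj q) \<in> arcs (Dstar N)" "(vj q, vk r) \<in> arcs (Dstar N)" "(vk r, vi p) \<in> arcs (Dstar N)"
      by (rule arcs; use tri in \<open>simp add: arcs_from_to_types(1)[OF t(1)] arcs_from_to_types(1)[OF t(2)]
        arcs_from_to_types(1)[OF t(3)] triangle_def\<close>)+
    then show "cmod (cell_at W (vi p) (vj q) (vk r)) = cmod (cell_at W (vi q) (vj r) (vk p))"
      using assms unfolding Z3_symmetric_solution_def by blast
  qed
qed

context standard_cells
begin

lemma val_level_solution: "level_solution N (\<lambda>p q r. of_real (val p q r))"
proof
  show "moduli_rotate N (\<lambda>p q r. of_real (val p q r))"
    unfolding moduli_rotate_def by (metis val_ijk_rotate)
qed (rule val_level_I val_level_II)+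

text \<open>The quotient \<open>h\<close> of the two solutions has modulus 1. On the square with levels \<open>l\<close>, \<open>l\<close>, \<open>l + 1\<close>, \<open>l + 1\<close> both satisfy an
  equation $P + P' = 0$ with two nonzero terms; passing from one solution to the other multiplies the two terms by phases,
  which therefore agree. This is the flatness that allows \<open>h\<close> to be gauged away.\<close>

lemma equivalent_cells:
  assumes W: "Z3_symmetric_solution N W"
    and start: "2 < N div 2 \<Longrightarrow> cmod (cell_at W (vi 1) (vj 1) (vk 2)) = cmod (of_real (val 1 1 2))"
  shows "cell_equivalent (Dstar N) W cells"
proof -
  define f where "f p q r = cell_at W (vi p) (vj q) (vk r)" for p q r
  define g where "g p q r = complex_of_real (val p q r)" for p q r
  \<comment> \<open>Outside triangles the value 1 keeps the modulus equal to 1 everywhere.\<close>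
  define h where "h p q r = (if triangle N p q r then f p q r / g p q r else 1)" for p q r
  interpret f: level_solution N f
    using Z3_symmetric_solution_levels[OF W] unfolding f_def .
  interpret g: level_solution N g
    using val_level_solution unfolding g_def .
  have nz: "g p q r \<noteq> 0" if "triangle N p q r" for p q r
    using val_nonzero[OF that] by (simp add: g_def)
  have moduli: "cmod (f p q r) = cmod (g p q r)" if "triangle N p q r" for p q r
    by (rule moduli_determined[OF f.level_solution_axioms g.level_solution_axioms nz phi_pos _ that])
      (use start in \<open>auto simp: f_def g_def\<close>)
  have unit: "cmod (h p q r) = 1" for p q r
    using moduli nz by (simp add: h_def norm_divide)
  have fgh: "f p q r = g p q r * h p q r" if "triangle N p q r" for p q r
    using nz[OF that] that by (simp add: h_def)
  have flat: "h l l l * cnj (h (l + 1) l l) * h (l + 1) (l + 1) l * cnj (h l (l + 1) l) =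
       h l l (l + 1) * cnj (h (l + 1) l (l + 1)) * h (l + 1) (l + 1) (l + 1) * cnj (h l (l + 1) (l + 1))"
    (is "?H = ?H'") if l: "1 \<le> l" "l + 1 < N div 2" for l
  proof -
    have tri: "triangle N p q r" if "p \<in> {l, l + 1}" "q \<in> {l, l + 1}" "r \<in> {l, l + 1}" for p q r
      using that l by (auto simp: triangle_def levels_def near_def)
    define P where "P = of_real (inverse (\<phi> l))
      * (g l l l * cnj (g (l + 1) l l) * g (l + 1) (l + 1) l * cnj (g l (l + 1) l))"
    define P' where "P' = of_real (inverse (\<phi> (l + 1))) * (g l l (l + 1) * cnj (g (l + 1) l (l + 1))
       * g (l + 1) (l + 1) (l + 1) * cnj (g l (l + 1) (l + 1)))"
    have "P + P' = 0"
      unfolding P_def P'_def by (rule g.square_phase[OF l])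
    then have P': "P' = - P" by (simp add: add_eq_0_iff)
    have F: "f l l l = g l l l * h l l l"
      "f (l + 1) l l = g (l + 1) l l * h (l + 1) l l"
      "f (l + 1) (l + 1) l = g (l + 1) (l + 1) l * h (l + 1) (l + 1) l"
      "f l (l + 1) l = g l (l + 1) l * h l (l + 1) l"
      "f l l (l + 1) = g l l (l + 1) * h l l (l + 1)"
      "f (l + 1) l (l + 1) = g (l + 1) l (l + 1) * h (l + 1) l (l + 1)"
      "f (l + 1) (l + 1) (l + 1) = g (l + 1) (l + 1) (l + 1) * h (l + 1) (l + 1) (l + 1)"
      "f l (l + 1) (l + 1) = g l (l + 1) (l + 1) * h l (l + 1) (l + 1)"
      by (rule fgh, rule tri; simp)+
    have split: "c * ((g1 * h1) * cnj (g2 * h2) * (g3 * h3) * cnj (g4 * h4))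
       = (c * (g1 * cnj g2 * g3 * cnj g4)) * (h1 * cnj h2 * h3 * cnj h4)"
      for c g1 g2 g3 g4 h1 h2 h3 h4 :: complex by simp
    have "P * ?H + P' * ?H' = 0"
      using f.square_phase[OF l]
      unfolding F split P_def P'_def .
    then have "P * (?H - ?H') = 0"
      unfolding P' by (simp only: right_diff_distrib mult_minus_left add_uminus_conv_diff)
    moreover have "P \<noteq> 0"
      unfolding P_def using nz tri phi_pos[of l] l by auto
    ultimately show ?thesis by (simp only: mult_eq_0_iff right_minus_eq) blast
  qed
  obtain x y z where xyz: "\<And>p q. cmod (x p q) = 1" "\<And>p q. cmod (y p q) = 1" "\<And>p q. cmod (z p q) = 1"
    "\<And>p q r. triangle N p q r \<Longrightarrow> h p q r = x p q * y q r * z r p"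
    using gauge[of h N, OF unit flat] by blast
  show ?thesis
  proof (rule cell_equivalentI[OF _ _ xyz(1-3)])
    show "rotation_invariant (Dstar N) W" "rotation_invariant (Dstar N) cells"
      using W cells_Z3_symmetric unfolding Z3_symmetric_solution_def cell_system_def by auto
    have t: "cyclic_types vi vj vk" by (simp add: cyclic_types_def)
    fix p q r assume "triangle N p q r"
    then show "cell_at W (vi p) (vj q) (vk r) = x p q * y q r * z r p * cell_at cells (vi p) (vj q) (vk r)"
      unfolding cell_at_cells[OF t] using fgh[of p q r] xyz(4)[of p q r] unfolding f_def g_def by simp
  qed
qed

end

text \<open>For \<open>N = 4\<close> there is only one level and \<open>W\<^sup>+\<close> and \<open>W\<^sup>-\<close> have the same cells; otherwise they differ on $(1,1,2)$.\<close>

lemma classification: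
  assumes plus: "standard_cells N 1 dp" and minus: "standard_cells N (-1) dm"
    and W: "Z3_symmetric_solution N W"
  shows "cell_equivalent (Dstar N) W (standard_cells.cells N 1 dp)
    \<or> cell_equivalent (Dstar N) W (standard_cells.cells N (-1) dm)"
proof (cases "2 < N div 2")
  case False
  then show ?thesis using standard_cells.equivalent_cells[OF plus W] by blast
next
  case True
  interpret p: standard_cells N 1 dp by fact
  interpret m: standard_cells N "-1" dm by fact
  let ?g = "\<lambda>p q r. complex_of_real (val_ijk N 1 dp p q r)"
  let ?h = "\<lambda>p q r. complex_of_real (val_ijk N (-1) dm p q r)"
  let ?f = "\<lambda>p q r. cell_at W (vi p) (vj q) (vk r)"
  have 1: "1 \<le> (1::nat)" "1 < N div 2" and 2: "1 \<le> (2::nat)" "2 < N div 2" using True by auto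
  have "p.one_sq 1 \<noteq> m.one_sq 1"
  proof -
    have "qint N 2 > 0" "qint N 3 > 0" "qint N 4 > 0" using True by (auto intro!: qint_pos[OF p.N4])
    then show ?thesis by (simp add: p.one_sq_def m.one_sq_def)
  qed
  then have "(val_one_up N 1 1)\<^sup>2 \<noteq> (val_one_up N (-1) 1)\<^sup>2"
    unfolding p.val_one_up_square[OF 1] m.val_one_up_square[OF 1] .
  then have "\<bar>val_one_up N 1 1\<bar> \<noteq> \<bar>val_one_up N (-1) 1\<bar>"
    by (metis power2_abs)
  then have "cmod (?g 1 1 2) \<noteq> cmod (?h 1 1 2)"
    using val_ijk_values(2)[of N 1 dp 1] val_ijk_values(2)[of N "-1" dm 1]
    unfolding norm_of_real one_add_one by simp
  then have "cmod (?f 1 1 2) = cmod (?g 1 1 2) \<or> cmod (?f 1 1 2) = cmod (?h 1 1 2)"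
    by (intro start_determined[OF Z3_symmetric_solution_levels[OF W] p.val_level_solution
      m.val_level_solution p.phi_pos[OF 1] p.phi_pos[OF 2] True])
  then show ?thesis
    using p.equivalent_cells[OF W] m.equivalent_cells[OF W] by blast
qed

lemma standard_cells_4n:
  assumes "1 \<le> n" "s = 1 \<or> s = -1"
  shows "standard_cells (4 * n) s (val_diag_4n n s)"
proof
  fix l assume l: "1 \<le> l" "l < 4 * n div 2"
  have N4: "4 * n \<ge> 4" using assms by simp
  show "val_diag_4n n s l = diag_cell (4 * n) s l"
  proof -
    consider "l < n" | "l = n" | "n < l" by linarith
    then show ?thesis
    proof cases
      case 1
      then show ?thesis by (simp add: val_diag_4n_def diag_cell_def Let_def)
    next
      case 2
      define X where "X = qint (4 * n) (2 * n)"
      have p: "qint (4 * n) 2 > 0" "X > 0" using assms unfolding X_def by (auto intro!: qint_pos[OF N4])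
      have root: "sqrt X / (qint (4 * n) 2 * y) * sqrt (qint (4 * n) 2 * X)
          = X / (sqrt (qint (4 * n) 2) * y)" for y
      proof -
        define r x where "r = sqrt (qint (4 * n) 2)" "x = sqrt X"
        have rx: "qint (4 * n) 2 = r * r" "X = x * x" "sqrt (r * r) = r" "sqrt (x * x) = x"
          "sqrt (r * r * (x * x)) = r * x" "r > 0"
          using p by (auto simp: r_x_def real_sqrt_mult)
        show ?thesis unfolding rx using rx(6) by simp
      qed
      have "val_diag_4n n s n = (-1) ^ (n + 1) * (X / (sqrt (qint (4 * n) 2)
          * sqrt (qint (4 * n) (2 * n - 1) * qint (4 * n) (2 * n + 1))))"
        by (simp add: val_diag_4n_def Let_def X_def real_sqrt_mult mult.assoc)
      moreover have "diag_cell (4 * n) s n = (-1) ^ (n + 1) * (sqrt X / (qint (4 * n) 2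
          * sqrt (qint (4 * n) (2 * n - 1) * qint (4 * n) (2 * n + 1))) * sqrt (qint (4 * n) 2 * X))"
        by (simp only: diag_cell_def X_def qint_N[OF N4] mult_zero_right add_0_right mult.assoc)
      ultimately show ?thesis unfolding 2 root by simp
    next
      case 3
      have "8 * n - 4 * l = 2 * (4 * n) - 4 * l" by simp
      then have "qint (4 * n) (8 * n - 4 * l) = - qint (4 * n) (4 * l)"
        using qint_reflect[OF N4, of "4 * l"] l by simp
      then show ?thesis using 3 by (simp add: val_diag_4n_def diag_cell_def Let_def)
    qed
  qed
qed (use assms in auto)

lemma standard_cells_4n2:
  assumes "1 \<le> n" "s = 1 \<or> s = -1"
  shows "standard_cells (4 * n + 2) s (val_diag_4n2 n s)"
proof
  fix l assume l: "1 \<le> l" "l < (4 * n + 2) div 2"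
  have N4: "4 * n + 2 \<ge> 4" using assms by simp
  have "8 * n + 4 - 4 * l = 2 * (4 * n + 2) - 4 * l" by simp
  then have "qint (4 * n + 2) (8 * n + 4 - 4 * l) = - qint (4 * n + 2) (4 * l)"
    using qint_reflect[OF N4, of "4 * l"] l by simp
  then show "val_diag_4n2 n s l = diag_cell (4 * n + 2) s l"
    by (simp add: val_diag_4n2_def diag_cell_def Let_def)
qed (use assms in auto)

theorem theorem8p2:
  fixes n :: nat
  assumes "1 \<le> n"
  shows "(Z3_symmetric_solution (4 * n) (W_4n n 1) \<and>
          Z3_symmetric_solution (4 * n) (W_4n n (-1)) \<and>
          (\<forall>W. Z3_symmetric_solution (4 * n) W \<longrightarrow>
             cell_equivalent (Dstar (4 * n)) W (W_4n n 1) \<or>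
             cell_equivalent (Dstar (4 * n)) W (W_4n n (-1))))
       \<and> (Z3_symmetric_solution (4 * n + 2) (W_4n2 n 1) \<and>
          Z3_symmetric_solution (4 * n + 2) (W_4n2 n (-1)) \<and>
          (\<forall>W. Z3_symmetric_solution (4 * n + 2) W \<longrightarrow>
             cell_equivalent (Dstar (4 * n + 2)) W (W_4n2 n 1) \<or>
             cell_equivalent (Dstar (4 * n + 2)) W (W_4n2 n (-1))))"
proof -
  interpret A: standard_cells "4 * n" 1 "val_diag_4n n 1"
    by (rule standard_cells_4n) (use assms in auto)
  interpret B: standard_cells "4 * n" "-1" "val_diag_4n n (-1)"
    by (rule standard_cells_4n) (use assms in auto)
  interpret C: standard_cells "4 * n + 2" 1 "val_diag_4n2 n 1"
    by (rule standard_cells_4n2) (use assms in auto)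
  interpret D: standard_cells "4 * n + 2" "-1" "val_diag_4n2 n (-1)"
    by (rule standard_cells_4n2) (use assms in auto)
  have e: "W_4n n 1 = A.cells" "W_4n n (-1) = B.cells" "W_4n2 n 1 = C.cells" "W_4n2 n (-1) = D.cells"
    unfolding fun_eq_iff A.cells_def B.cells_def C.cells_def D.cells_def W_4n_def W_4n2_def by blast+
  show ?thesis
    unfolding e
    by (intro conjI allI impI A.cells_Z3_symmetric B.cells_Z3_symmetric C.cells_Z3_symmetric
      D.cells_Z3_symmetric classification A.standard_cells_axioms B.standard_cells_axioms
      C.standard_cells_axioms D.standard_cells_axioms)
qed

end
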